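(* Let $n\in\mathbb{N}$, let $\mu\in[0,+\infty)^n$ and let $X,Y$ be two centered Gaussian random vectors in $\mathbb{R}^n$ such that $d_X(i,j)\le d_Y(i,j)$ for all $i,j\in[n]$. Then, for all $\beta>0$, $$\mathbb{E}\left[\left(\mathrm{P}_{H_X^\perp}(f_\beta(X+\mu))+\frac1\beta\right)^2\right]\le \mathbb{E}\left[\left(\mathrm{P}_{H_Y^\perp}(f_\beta(Y+\mu))+\frac1\beta\right)^2\right],$$ and in particular $$\mathbb{E}\left[\left(\mathrm{P}_{H_X^\perp}\Big(\max_{1\le i\le n}(X_i+\mu_i)\Big)\right)^2\right]\le \mathbb{E}\left[\left(\mathrm{P}_{H_Y^\perp}\Big(\max_{1\le i\le n}(Y_i+\mu_i)\Big)\right)^2\right].$$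
   Context: $[n]=\{1,\dots,n\}$. For $\beta>0$, $f_\beta:\mathbb{R}^n\to\mathbb{R}$ is $f_\beta(x)=\frac1\beta\log\left(\sum_{k=1}^n e^{\beta x_k}\right)$. For a centered Gaussian random vector $X=(X_1,\dots,X_n)$ (its covariance matrix may be singular), $d_X(i,j)=(\mathbb{E}[(X_i-X_j)^2])^{1/2}$. $H_X=\mathrm{span}(X_1,\dots,X_n)\subset L^2(\Omega,\mathbb{P})$, where $(\Omega,\mathbb{P})$ is the underlying probability space, and $\mathrm{P}_{H_X^\perp}$ is the orthogonal projection of $L^2(\Omega,\mathbb{P})$ onto the orthogonal complement $H_X^\perp$ of $H_X$. *)

theory Defs
  imports "HOL-Probability.Probability"
begin

(* Gaussian laws may be degenerate (constants). *)
definition gaussian_rv :: "'a measure \<Rightarrow> ('a \<Rightarrow> real) \<Rightarrow> bool" where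
  "gaussian_rv M Z \<longleftrightarrow> Z \<in> borel_measurable M \<and>
     ((\<exists>m. AE \<omega> in M. Z \<omega> = m) \<or>
      (\<exists>m \<sigma>. \<sigma> > 0 \<and> distributed M lborel Z (normal_density m \<sigma>)))"

definition gaussian_vector :: "'a measure \<Rightarrow> ('a \<Rightarrow> real ^ 'n) \<Rightarrow> bool" where
  "gaussian_vector M X \<longleftrightarrow> X \<in> borel_measurable M \<and>
     (\<forall>u. gaussian_rv M (\<lambda>\<omega>. u \<bullet> X \<omega>))"

definition centered_gaussian_vector :: "'a measure \<Rightarrow> ('a \<Rightarrow> real ^ 'n) \<Rightarrow> bool" where
  "centered_gaussian_vector M X \<longleftrightarrow> gaussian_vector M X \<and>
     (\<forall>i. (LINT \<omega>|M. X \<omega> $ i) = 0)"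

definition canonical_dist :: "'a measure \<Rightarrow> ('a \<Rightarrow> real ^ 'n) \<Rightarrow> 'n \<Rightarrow> 'n \<Rightarrow> real" where
  "canonical_dist M X i j = sqrt (LINT \<omega>|M. (X \<omega> $ i - X \<omega> $ j)\<^sup>2)"

definition softmax :: "real \<Rightarrow> real ^ 'n \<Rightarrow> real" where
  "softmax \<beta> x = (1 / \<beta>) * ln (\<Sum>k\<in>UNIV. exp (\<beta> * x $ k))"

(* Elements of L2 are represented by functions; almost everywhere equal functions
   are not identified. *)
definition L2 :: "'a measure \<Rightarrow> ('a \<Rightarrow> real) set" where
  "L2 M = {f \<in> borel_measurable M. integrable M (\<lambda>\<omega>. (f \<omega>)\<^sup>2)}"

definition orth_complement :: "'a measure \<Rightarrow> ('a \<Rightarrow> real) set \<Rightarrow> ('a \<Rightarrow> real) set" where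
  "orth_complement M H = {f \<in> L2 M. \<forall>h\<in>H. (LINT \<omega>|M. f \<omega> * h \<omega>) = 0}"

(* A representative of the orthogonal projection of Z onto a closed subspace V of L2.
   For Z in L2 it exists and is unique up to almost everywhere equality, so integrals
   involving it do not depend on the choice. *)
definition orth_proj :: "'a measure \<Rightarrow> ('a \<Rightarrow> real) set \<Rightarrow> ('a \<Rightarrow> real) \<Rightarrow> 'a \<Rightarrow> real" where
  "orth_proj M V Z = (SOME W. W \<in> V \<and> (\<forall>v\<in>V. (LINT \<omega>|M. (Z \<omega> - W \<omega>) * v \<omega>) = 0))"

(* span (X_1, ..., X_n): the combinations c_1 X_1 + ... + c_n X_n. *)
definition gaussian_span :: "('a \<Rightarrow> real ^ 'n) \<Rightarrow> ('a \<Rightarrow> real) set" where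
  "gaussian_span X = {(\<lambda>\<omega>. \<Sum>i\<in>UNIV. c i * X \<omega> $ i) | c. True}"

end

theory Submission
  imports Defs "HOL-Real_Asymp.Real_Asymp"
begin

text \<open>
  Let \<open>X\<close> and \<open>Y\<close> be independent, \<open>Z\<^sub>t = cos t X + sin t Y\<close>, and write \<open>f\<close> for \<open>f\<^sub>\<beta>(\<cdot> + \<mu>)\<close>. Gaussian
  integration by parts identifies the projection of \<open>f(Z\<^sub>t)\<close> onto the span of \<open>Z\<^sub>t\<close> as
  \<open>c\<^sub>t \<bullet> Z\<^sub>t\<close> with \<open>c\<^sub>t = E \<nabla>f(Z\<^sub>t)\<close>, a point of the simplex. Hence the quantity to be compared is
  \<open>min\<^sub>c \<phi>(c, t) = \<phi>(c\<^sub>t, t)\<close> with \<open>\<phi>(c, t) = E (f(Z\<^sub>t) + 1/\<beta> - c \<bullet> Z\<^sub>t)\<^sup>2\<close>. For fixed \<open>c\<close> the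
  \<open>t\<close>-derivative of \<open>\<phi>\<close> is \<open>sin t cos t\<close> times the expected contraction of the Hessian of the square with
  \<open>D = Cov Y - Cov X\<close>. With \<open>p = \<nabla>f\<close> and \<open>d\<^sub>j\<^sub>k = D\<^sub>j\<^sub>j + D\<^sub>k\<^sub>k - 2 D\<^sub>j\<^sub>k \<ge> 0\<close> this contraction equals
  \<open>2 \<Sum> d\<^sub>j\<^sub>k p\<^sub>j c\<^sub>k - \<Sum> d\<^sub>j\<^sub>k c\<^sub>j c\<^sub>k + \<beta> (f(x) - c \<bullet> x) \<Sum> d\<^sub>j\<^sub>k p\<^sub>j p\<^sub>k\<close>, where \<open>f(x) \<ge> c \<bullet> x\<close> because
  \<open>\<mu> \<ge> 0\<close>; the summand \<open>1/\<beta>\<close> is what makes the first two terms come out. Its expectation is nonnegative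
  for \<open>c = c\<^sub>t\<close>, and nearly so for \<open>c = c\<^sub>s\<close> with \<open>s\<close> close to \<open>t\<close>; since \<open>\<phi>(c\<^sub>s, s) \<le> \<phi>(c\<^sub>t, s)\<close>, this
  suffices for monotonicity of the minimum without differentiating \<open>c\<^sub>t\<close>. The statement about maxima follows
  by letting \<open>\<beta> \<rightarrow> \<infinity>\<close> along a subsequence for which the vectors \<open>c\<close> converge.
\<close>

section \<open>Uniqueness of Fourier transforms on finite-dimensional spaces\<close>

text \<open>\<open>Levy_uniqueness\<close> concerns probability laws, so both measures are first
  normalised by their common mass; the zero measure is treated apart. The free phase
  \<open>b\<close> turns cosine into sine and thus gives both parts of the characteristic
  function.\<close>

lemma finite_measure_eqI_cos_real:
  fixes A B :: "real measure"
  assumes "finite_measure A" "finite_measure B"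
    and sA [measurable_cong]: "sets A = sets borel" and sB [measurable_cong]: "sets B = sets borel"
    and eq: "\<And>s b. (LINT t|A. cos (s * t + b)) = (LINT t|B. cos (s * t + b))"
  shows "A = B"
proof -
  interpret A: finite_measure A by fact
  interpret B: finite_measure B by fact
  have spA: "space A = UNIV" and spB: "space B = UNIV"
    using sA sB by (metis sets_eq_imp_space_eq space_borel)+
  define m where "m = measure A UNIV"
  \<comment> \<open>Frequency and phase zero compare the total masses.\<close>
  have m': "m = measure B UNIV"
    using eq[of 0 0] by (simp add: m_def spA spB)
  show ?thesis
  proof (cases "m = 0")
    case True
    have "emeasure A X = 0" "emeasure B X = 0" for X
    proof -
      have "measure A X \<le> 0" "measure B X \<le> 0"
        using A.bounded_measure[of X] B.bounded_measure[of X] True m' by (auto simp: m_def spA spB)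
      then show "emeasure A X = 0" "emeasure B X = 0"
        using measure_nonneg[of A X] measure_nonneg[of B X]
        by (simp_all add: A.emeasure_eq_measure B.emeasure_eq_measure)
    qed
    then show ?thesis by (intro measure_eqI) (auto simp: sA sB)
  next
    case False
    then have m: "m > 0" by (simp add: m_def less_le)
    define A' where "A' = density A (\<lambda>_. ennreal (1 / m))"
    define B' where "B' = density B (\<lambda>_. ennreal (1 / m))"
    have em: "ennreal (1 / m) * ennreal m = 1" "ennreal m * ennreal (1 / m) = 1"
      using m by (simp_all flip: ennreal_mult')
    have "emeasure A' (space A') = 1" "emeasure B' (space B') = 1"
      using em(1) m' by (simp_all add: A'_def B'_def emeasure_density_const spA spB
          A.emeasure_eq_measure B.emeasure_eq_measure m_def)
    then have pA: "prob_space A'" and pB: "prob_space B'"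
      by (auto intro!: prob_spaceI)
    have sA' [measurable_cong]: "sets A' = sets borel" and sB' [measurable_cong]: "sets B' = sets borel"
      by (auto simp: A'_def B'_def sA sB)
    have rA: "real_distribution A'" and rB: "real_distribution B'"
      by (auto simp: real_distribution_def real_distribution_axioms_def pA pB sA' sB')
    interpret A': real_distribution A' by fact
    interpret B': real_distribution B' by fact
    have eq': "(LINT t|A'. cos (s * t + b)) = (LINT t|B'. cos (s * t + b))" for s b
      using m by (simp add: A'_def B'_def integral_density eq)
    have sin_cos': "sin x = cos (x + - (pi / 2))" for x :: real by (simp add: cos_diff)
    have "char A' s = char B' s" for s
    proof (rule complex_eqI)
      have iA: "integrable A' (\<lambda>x. iexp (s * x))"
        by (rule A'.integrable_const_bound[of _ 1]) (auto intro!: measurable_compose[OF _ borel_measurable_continuous_onI] continuous_intros)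
      have iB: "integrable B' (\<lambda>x. iexp (s * x))"
        by (rule B'.integrable_const_bound[of _ 1]) (auto intro!: measurable_compose[OF _ borel_measurable_continuous_onI] continuous_intros)
      have "Re (char A' s) = (LINT t|A'. Re (iexp (s * t)))" "Re (char B' s) = (LINT t|B'. Re (iexp (s * t)))"
        "Im (char A' s) = (LINT t|A'. Im (iexp (s * t)))" "Im (char B' s) = (LINT t|B'. Im (iexp (s * t)))"
        unfolding char_def using iA iB by simp_all
      then show "Re (char A' s) = Re (char B' s)" "Im (char A' s) = Im (char B' s)"
        using eq'[of s 0] eq'[of s "- (pi / 2)"] by (simp_all add: Re_exp Im_exp sin_cos')
    qed
    then have "A' = B'" by (intro Levy_uniqueness[OF rA rB]) auto
    then have *: "density A' (\<lambda>_. ennreal m) = density B' (\<lambda>_. ennreal m)" by simp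
    have "density A' (\<lambda>_. ennreal m) = A" "density B' (\<lambda>_. ennreal m) = B"
      by (simp_all add: A'_def B'_def density_density_eq em density_1)
    with * show ?thesis by simp
  qed
qed

text \<open>Weighting \<open>P\<close> by \<open>W1\<close> and \<open>Q\<close> by
  \<open>W2\<close> and pushing forward along \<open>T1\<close> and \<open>T2\<close> gives two
  finite measures on the line with equal cosine integrals. They coincide, and both sides are the
  mass they give to \<open>B\<close>.\<close>

lemma integral_indicator_eqI_cos:
  fixes T1 :: "'a \<Rightarrow> real" and T2 :: "'b \<Rightarrow> real"
  assumes "finite_measure P" "finite_measure Q"
    and [measurable]: "T1 \<in> borel_measurable P" "T2 \<in> borel_measurable Q"
      "W1 \<in> borel_measurable P" "W2 \<in> borel_measurable Q"
    and W1: "\<And>x. 0 \<le> W1 x" "\<And>x. W1 x \<le> C"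
    and W2: "\<And>x. 0 \<le> W2 x" "\<And>x. W2 x \<le> C"
    and eq: "\<And>s b. (LINT x|P. W1 x * cos (s * T1 x + b)) = (LINT x|Q. W2 x * cos (s * T2 x + b))"
    and [measurable]: "B \<in> sets borel"
  shows "(LINT x|P. W1 x * indicator B (T1 x)) = (LINT x|Q. W2 x * indicator B (T2 x))"
proof -
  interpret P: finite_measure P by fact
  interpret Q: finite_measure Q by fact
  define P' where "P' = distr (density P W1) borel T1"
  define Q' where "Q' = distr (density Q W2) borel T2"
  have "integrable P W1" "integrable Q W2"
    using W1 W2 by (auto intro!: P.integrable_const_bound[of _ C] Q.integrable_const_bound[of _ C])
  then have "finite_measure (density P W1)" "finite_measure (density Q W2)"
    using W1 W2 by (auto intro!: finite_measureI simp: emeasure_density nn_integral_eq_integral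
       simp del: nn_integral_indicator cong: nn_integral_cong)
  then have f: "finite_measure P'" "finite_measure Q'"
    by (auto simp: P'_def Q'_def intro!: finite_measure.finite_measure_distr)
  have PQ: "P' = Q'"
    by (rule finite_measure_eqI_cos_real[OF f])
      (use W1 W2 eq in \<open>simp_all add: P'_def Q'_def integral_distr integral_density\<close>)
  have "(LINT t|P'. indicator B t) = (LINT x|P. W1 x * indicator B (T1 x))"
    unfolding P'_def by (subst integral_distr) (use W1 in \<open>auto simp: integral_density\<close>)
  moreover have "(LINT t|Q'. indicator B t) = (LINT x|Q. W2 x * indicator B (T2 x))"
    unfolding Q'_def by (subst integral_distr) (use W2 in \<open>auto simp: integral_density\<close>)
  ultimately show ?thesis using PQ by metis
qed

text \<open>
  The coordinates are converted one at a time from frequencies to half-line indicators by the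
  one-dimensional uniqueness theorem; the weights \<open>1 + cos\<close> keep the measures involved nonnegative.
\<close>

lemma finite_measure_eqI_cos:
  fixes P Q :: "(real ^ 'n) measure"
  assumes "finite_measure P" "finite_measure Q"
    and sP [measurable_cong]: "sets P = sets borel" and sQ [measurable_cong]: "sets Q = sets borel"
    and eq: "\<And>u b. (LINT x|P. cos (u \<bullet> x + b)) = (LINT x|Q. cos (u \<bullet> x + b))"
  shows "P = Q"
proof -
  interpret P: finite_measure P by fact
  interpret Q: finite_measure Q by fact
  have spP: "space P = UNIV" and spQ: "space Q = UNIV"
    using sP sQ by (metis sets_eq_imp_space_eq space_borel)+
  have [measurable]: "(\<lambda>x. x $ k) \<in> borel_measurable borel" for k :: 'n
    by (intro borel_measurable_continuous_onI continuous_intros)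
  \<comment> \<open>\<open>F\<close> holds the coordinates already converted to half-lines; the
    others still enter through frequencies. The empty set is the hypothesis, and \<open>UNIV\<close>
    gives the masses of lower orthants.\<close>
  have key: "\<forall>u b. (LINT x|P. (\<Prod>k\<in>F. indicator {..a k} (x $ k)) * cos ((\<Sum>k\<in>-F. u k * x $ k) + b))
      = (LINT x|Q. (\<Prod>k\<in>F. indicator {..a k} (x $ k)) * cos ((\<Sum>k\<in>-F. u k * x $ k) + b))"
    for F :: "'n set" and a :: "'n \<Rightarrow> real"
  proof (induction F rule: finite_induct[OF finite])
    case 1
    show ?case
    proof (intro allI)
      fix u :: "'n \<Rightarrow> real" and b
      show "(LINT x|P. (\<Prod>k\<in>{}. indicator {..a k} (x $ k)) * cos ((\<Sum>k\<in>-{}. u k * x $ k) + b))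
      = (LINT x|Q. (\<Prod>k\<in>{}. indicator {..a k} (x $ k)) * cos ((\<Sum>k\<in>-{}. u k * x $ k) + b))"
        using eq[of "\<chi> k. u k" b] by (simp add: inner_vec_def)
    qed
  next
    case (2 k F)
    define w :: "real^'n \<Rightarrow> real" where "w x = (\<Prod>k\<in>F. indicator {..a k} (x $ k))" for x
    have [measurable]: "w \<in> borel_measurable borel" unfolding w_def by measurable
    have w: "0 \<le> w x" "w x \<le> 1" for x
      by (auto simp: w_def intro!: prod_nonneg prod_le_1 split: split_indicator)
    show ?case
    proof (intro allI)
      fix u :: "'n \<Rightarrow> real" and b
      define U where "U x = (\<Sum>k\<in>-insert k F. u k * x $ k)" for x :: "real^'n"
      have [measurable]: "U \<in> borel_measurable borel" unfolding U_def by measurable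
      \<comment> \<open>The factor \<open>r\<close> scales all frequencies that stay unconverted;
        the values \<open>0\<close>, \<open>1\<close> and \<open>-1\<close> are the ones used
        below.\<close>
      have IH: "(LINT x|P. w x * cos (s * x $ k + r * U x + b)) = (LINT x|Q. w x * cos (s * x $ k + r * U x + b))" for r s b
      proof -
        have "(\<Sum>l\<in>-F. ((\<lambda>l. r * u l)(k := s)) l * x $ l) = s * x $ k + r * U x" for x :: "real^'n"
        proof -
          have "-F = insert k (-insert k F)" using 2 by auto
          then show ?thesis
            by (auto simp: U_def sum_distrib_left mult.assoc intro!: sum.cong)
        qed
        with 2(3)[rule_format, of "(\<lambda>l. r * u l)(k := s)" b] show ?thesis by (simp add: w_def)
      qed
      have int: "integrable P (\<lambda>x. w x * h x)" "integrable Q (\<lambda>x. w x * h x)"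
        if "h \<in> borel_measurable borel" "\<And>x. \<bar>h x\<bar> \<le> 1" for h
        using that w by (auto intro!: P.integrable_const_bound[of _ 1] Q.integrable_const_bound[of _ 1] AE_I2 mult_le_one simp: abs_mult)
      have wcos: "0 \<le> w x * (1 + cos y)" "w x * (1 + cos y) \<le> 2" for x y
      proof -
        have "0 \<le> 1 + cos y" "1 + cos y \<le> 2"
          using cos_ge_minus_one[of y] cos_le_one[of y] by linarith+
        then show "0 \<le> w x * (1 + cos y)" "w x * (1 + cos y) \<le> 2"
          using w[of x] mult_mono[of "w x" 1 "1 + cos y" 2] by auto
      qed
      have step: "(LINT x|P. (w x * (1 + cos (U x + c))) * indicator {..a k} (x $ k))
         = (LINT x|Q. (w x * (1 + cos (U x + c))) * indicator {..a k} (x $ k))" for c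
      proof (rule integral_indicator_eqI_cos[OF assms(1,2), where C = 2])
        show "0 \<le> w x * (1 + cos (U x + c))" "0 \<le> w x * (1 + cos (U x + c))"
          "w x * (1 + cos (U x + c)) \<le> 2" "w x * (1 + cos (U x + c)) \<le> 2" for x
          by (rule wcos)+
        fix s b
        \<comment> \<open>Product-to-sum splits the weighted cosine into three integrals, each an
          instance of \<open>IH\<close>.\<close>
        have "w x * (1 + cos (U x + c)) * cos (s * x $ k + b) =
            w x * cos (s * x $ k + 0 * U x + b) + (w x * cos (s * x $ k + 1 * U x + (b + c)) + w x * cos (s * x $ k + (-1) * U x + (b - c))) / 2" for x
        proof -
          have "v * (1 + cos r) * cos t = v * cos t + (v * cos (t + r) + v * cos (t - r)) / 2" for v r t :: real
            by (simp add: cos_add cos_diff algebra_simps)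
          from this[of "w x" "U x + c" "s * x $ k + b"] show ?thesis by (simp add: algebra_simps)
        qed
        then show "(LINT x|P. w x * (1 + cos (U x + c)) * cos (s * x $ k + b)) = (LINT x|Q. w x * (1 + cos (U x + c)) * cos (s * x $ k + b))"
          using IH[of s 0 b] IH[of s 1 "b + c"] IH[of s "-1" "b - c"] by (simp add: int)
      qed measurable
      \<comment> \<open>Subtracting the weights with phases \<open>b\<close> and
        \<open>b + pi\<close> cancels the constant \<open>1\<close> and doubles the cosine.\<close>
      have two: "(LINT x|R. (w x * (1 + cos (U x + b))) * indicator {..a k} (x $ k)) - (LINT x|R. (w x * (1 + cos (U x + (b + pi)))) * indicator {..a k} (x $ k))
          = 2 * (LINT x|R. w x * (indicator {..a k} (x $ k) * cos (U x + b)))" if R: "R = P \<or> R = Q" for R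
      proof -
        have i: "integrable R (\<lambda>x. w x * indicator {..a k} (x $ k))" "integrable R (\<lambda>x. w x * (indicator {..a k} (x $ k) * cos (U x + c)))" for c
          using R by (auto intro!: int mult_le_one simp: abs_mult split: split_indicator)
        have "(LINT x|R. (w x * (1 + cos (U x + c))) * indicator {..a k} (x $ k))
          = (LINT x|R. w x * indicator {..a k} (x $ k)) + (LINT x|R. w x * (indicator {..a k} (x $ k) * cos (U x + c)))" for c
          by (subst Bochner_Integration.integral_add[OF i, symmetric]) (simp add: algebra_simps)
        moreover have "(LINT x|R. w x * (indicator {..a k} (x $ k) * cos (U x + (b + pi)))) = - (LINT x|R. w x * (indicator {..a k} (x $ k) * cos (U x + b)))"
          by (simp add: add.assoc[symmetric] flip: Bochner_Integration.integral_minus)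
        ultimately show ?thesis by simp
      qed
      have "(LINT x|P. w x * (indicator {..a k} (x $ k) * cos (U x + b))) = (LINT x|Q. w x * (indicator {..a k} (x $ k) * cos (U x + b)))"
        using two[of P] two[of Q] step[of b] step[of "b + pi"] by simp
      then show "(LINT x|P. (\<Prod>k\<in>insert k F. indicator {..a k} (x $ k)) * cos ((\<Sum>k\<in>-insert k F. u k * x $ k) + b))
        = (LINT x|Q. (\<Prod>k\<in>insert k F. indicator {..a k} (x $ k)) * cos ((\<Sum>k\<in>-insert k F. u k * x $ k) + b))"
        using 2 by (simp add: w_def U_def ac_simps)
    qed
  qed
  have ind: "(\<Prod>k\<in>UNIV. indicator {..a $ k} (x $ k)) = (indicator {..a} x :: real)" for a x :: "real^'n"
    by (auto simp: indicator_def less_eq_vec_def)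
  have m: "measure P {..a} = measure Q {..a}" for a :: "real^'n"
    using key[of "\<lambda>k. a $ k" UNIV, rule_format, of "\<lambda>_. 0" 0] by (simp add: ind spP spQ)
  show ?thesis
  \<comment> \<open>Lower orthants are stable under intersection, generate the Borel sets, and
    exhaust the space along the corners \<open>(i, ..., i)\<close>.\<close>
  proof (rule measure_eqI_generator_eq)
    have "{..a} \<inter> {..b} = {..inf a b}" for a b :: "real^'n" by auto
    then show "Int_stable (range (\<lambda>a :: real^'n. {..a}))"
      by (auto simp: Int_stable_def)
    show "range (\<lambda>a :: real^'n. {..a}) \<subseteq> Pow UNIV" by auto
    show "emeasure P X = emeasure Q X" if "X \<in> range (\<lambda>a :: real^'n. {..a})" for X
      using that m by (auto simp: P.emeasure_eq_measure Q.emeasure_eq_measure)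
    show "sets P = sigma_sets UNIV (range (\<lambda>a :: real^'n. {..a}))" "sets Q = sigma_sets UNIV (range (\<lambda>a :: real^'n. {..a}))"
      using sP sQ by (auto simp: borel_eq_atMost)
    show "range (\<lambda>i::nat. {..(\<chi> k::'n. real i)}) \<subseteq> range (\<lambda>a :: real^'n. {..a})" by auto
    have "\<exists>i::nat. x \<le> (\<chi> k. real i)" for x :: "real^'n"
    proof -
      obtain i where "norm x \<le> real i" using real_arch_simple by blast
      then show ?thesis
        by (auto simp: less_eq_vec_def intro!: exI[of _ i] order_trans[OF abs_le_D1[OF component_le_norm_cart]])
    qed
    then show "(\<Union>i::nat. {..(\<chi> k::'n. real i)}) = UNIV" by auto
  qed (auto simp: P.emeasure_eq_measure)
qed

section \<open>One-dimensional Gaussian laws\<close>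

text \<open>The standard normal density has derivative \<open>- x\<close> times itself, so the
  difference of the two integrands is the derivative of density times \<open>\<psi>\<close>. Linear
  growth makes that product vanish at both ends of the line.\<close>

lemma std_normal_integration_by_parts:
  fixes \<psi> \<psi>' :: "real \<Rightarrow> real"
  assumes der: "\<And>x. (\<psi> has_real_derivative \<psi>' x) (at x)"
    and cont: "continuous_on UNIV \<psi>'"
    and g: "\<And>x. \<bar>\<psi> x\<bar> \<le> C * (1 + \<bar>x\<bar>)" and g': "\<And>x. \<bar>\<psi>' x\<bar> \<le> C * (1 + \<bar>x\<bar>)"
  shows "(LINT x|std_normal_distribution. x * \<psi> x) = (LINT x|std_normal_distribution. \<psi>' x)"
proof -
  let ?\<phi> = "std_normal_density"
  have cont\<psi>: "continuous_on UNIV \<psi>"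
    using der by (intro DERIV_continuous_on) (auto intro: has_field_derivative_at_within)
  have [measurable]: "\<psi> \<in> borel_measurable borel" "\<psi>' \<in> borel_measurable borel"
    using cont cont\<psi> by (auto intro: borel_measurable_continuous_onI)
  have C: "0 \<le> C" using g[of 0] by simp
  have imom: "integrable lborel (\<lambda>x. ?\<phi> x * (C * (1 + \<bar>x\<bar>) + C * (\<bar>x\<bar> + \<bar>x\<bar>^2)))"
  proof -
    have "integrable lborel (\<lambda>x. C * ?\<phi> x + 2 * C * (?\<phi> x * \<bar>x\<bar>^1) + C * (?\<phi> x * \<bar>x\<bar>^2))"
      by (intro Bochner_Integration.integrable_add integrable_mult_right integrable_std_normal_moment_abs) simp
    then show ?thesis by (simp add: algebra_simps)
  qed
  have i1: "integrable lborel (\<lambda>x. ?\<phi> x * (x * \<psi> x))"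
  proof (rule Bochner_Integration.integrable_bound[OF imom], measurable, rule AE_I2)
    fix x :: real
    have "\<bar>x\<bar> * \<bar>\<psi> x\<bar> \<le> \<bar>x\<bar> * (C * (1 + \<bar>x\<bar>))" by (intro mult_left_mono g) simp
    also have "\<dots> \<le> C * (1 + \<bar>x\<bar>) + C * (\<bar>x\<bar> + \<bar>x\<bar>^2)" using C by (simp add: algebra_simps power2_eq_square)
    finally show "norm (?\<phi> x * (x * \<psi> x)) \<le> norm (?\<phi> x * (C * (1 + \<bar>x\<bar>) + C * (\<bar>x\<bar> + \<bar>x\<bar>^2)))"
      using C by (simp add: abs_mult mult_left_mono)
  qed
  have i2: "integrable lborel (\<lambda>x. ?\<phi> x * \<psi>' x)"
  proof (rule Bochner_Integration.integrable_bound[OF imom], measurable, rule AE_I2)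
    fix x :: real
    have "\<bar>\<psi>' x\<bar> \<le> C * (1 + \<bar>x\<bar>) + C * (\<bar>x\<bar> + \<bar>x\<bar>^2)" using C g'[of x] by (smt (verit) mult_nonneg_nonneg zero_le_power2)
    then show "norm (?\<phi> x * \<psi>' x) \<le> norm (?\<phi> x * (C * (1 + \<bar>x\<bar>) + C * (\<bar>x\<bar> + \<bar>x\<bar>^2)))"
      using C by (simp add: abs_mult mult_left_mono)
  qed
  define f where "f x = ?\<phi> x * \<psi>' x - ?\<phi> x * (x * \<psi> x)" for x
  have d\<phi>: "(?\<phi> has_real_derivative - x * ?\<phi> x) (at x)" for x
    unfolding std_normal_density_def[abs_def]
    by (auto intro!: derivative_eq_intros simp: field_simps)
  have bnd: "\<bar>?\<phi> x * \<psi> x\<bar> \<le> C * ((1 + \<bar>x\<bar>) * exp (- x\<^sup>2 / 2))" for x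
  proof -
    have "?\<phi> x \<le> exp (- x\<^sup>2 / 2)"
      unfolding std_normal_density_def using pi_ge_two by (intro mult_left_le_one_le) (auto simp: divide_simps)
    then have "?\<phi> x * \<bar>\<psi> x\<bar> \<le> exp (- x\<^sup>2 / 2) * (C * (1 + \<bar>x\<bar>))"
      by (intro mult_mono g) auto
    then show ?thesis by (simp add: abs_mult mult_ac)
  qed
  have "((\<lambda>x. C * ((1 + \<bar>x\<bar>) * exp (- x\<^sup>2 / 2))) \<longlongrightarrow> 0) at_top"
    by real_asymp
  then have l1: "((\<lambda>x. ?\<phi> x * \<psi> x) \<longlongrightarrow> 0) at_top"
    by (rule Lim_null_comparison[rotated]) (use bnd in simp)
  have "((\<lambda>x. C * ((1 + \<bar>x\<bar>) * exp (- x\<^sup>2 / 2))) \<longlongrightarrow> 0) at_bot"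
    by real_asymp
  then have l2: "((\<lambda>x. ?\<phi> x * \<psi> x) \<longlongrightarrow> 0) at_bot"
    by (rule Lim_null_comparison[rotated]) (use bnd in simp)
  have "(LBINT x=-\<infinity>..\<infinity>. f x) = 0 - 0"
  proof (rule interval_integral_FTC_integrable[where F = "\<lambda>x. ?\<phi> x * \<psi> x"])
    show "((\<lambda>x. ?\<phi> x * \<psi> x) has_vector_derivative f x) (at x)" for x
      unfolding has_real_derivative_iff_has_vector_derivative[symmetric] f_def
      by (auto intro!: derivative_eq_intros d\<phi> der)
    show "isCont f x" for x
    proof -
      have "continuous_on UNIV f"
        unfolding f_def[abs_def] std_normal_density_def by (intro continuous_intros cont cont\<psi>) auto
      then show ?thesis by (simp add: continuous_on_eq_continuous_at)
    qed
    show "set_integrable lborel (einterval (-\<infinity>) \<infinity>) f"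
      using i1 i2 by (simp add: set_integrable_def f_def[abs_def])
    show "(((\<lambda>x. ?\<phi> x * \<psi> x) \<circ> real_of_ereal) \<longlongrightarrow> 0) (at_right (-\<infinity>))"
      "(((\<lambda>x. ?\<phi> x * \<psi> x) \<circ> real_of_ereal) \<longlongrightarrow> 0) (at_left \<infinity>)"
      unfolding ereal_tendsto_simps by (rule l2 l1)+
  qed simp
  then have "(LINT x|lborel. ?\<phi> x * \<psi>' x) = (LINT x|lborel. ?\<phi> x * (x * \<psi> x))"
    using i1 i2 by (simp add: interval_lebesgue_integral_def set_lebesgue_integral_def f_def)
  then show ?thesis by (simp add: integral_density)
qed

text \<open>Removes the case distinction of \<open>gaussian_rv\<close>: an almost sure constant of
  mean zero is zero, which is the scale \<open>\<sigma> = 0\<close>.\<close>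

lemma centered_gaussian_rv_distr:
  assumes "prob_space M" and Z: "gaussian_rv M Z" and mean: "(LINT \<omega>|M. Z \<omega>) = 0"
  obtains \<sigma> where "0 \<le> \<sigma>" "distr M borel Z = distr std_normal_distribution borel (\<lambda>x. \<sigma> * x)"
proof -
  interpret prob_space M by fact
  interpret std: real_distribution std_normal_distribution by (rule real_dist_normal_dist)
  have [measurable]: "Z \<in> borel_measurable M" using Z by (simp add: gaussian_rv_def)
  from Z consider m where "AE \<omega> in M. Z \<omega> = m"
    | m \<sigma> where "\<sigma> > 0" "distributed M lborel Z (normal_density m \<sigma>)"
    unfolding gaussian_rv_def by blast
  then show ?thesis
  proof cases
    case 1
    then have "(LINT \<omega>|M. Z \<omega>) = (LINT \<omega>|M. m)" by (intro integral_cong_AE) auto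
    then have "m = 0" using mean by (simp add: prob_space)
    then have "distr M borel Z = distr M borel (\<lambda>_. 0)"
      using 1 by (intro distr_cong_AE) auto
    also have "\<dots> = distr std_normal_distribution borel (\<lambda>x. 0 * x)" by simp
    finally show ?thesis by (intro that[of 0]) auto
  next
    case 2
    have "m = 0" using normal_distributed_expectation[OF 2] mean by simp
    then have "distributed M lborel (\<lambda>x. Z x / \<sigma>) std_normal_density"
      using 2 normal_standard_normal_convert[OF 2(1), of Z m] by simp
    then have d: "distr M lborel (\<lambda>x. Z x / \<sigma>) = std_normal_distribution"
      by (simp add: distributed_def)
    have "distr M borel Z = distr (distr M lborel (\<lambda>x. Z x / \<sigma>)) borel (\<lambda>x. \<sigma> * x)"
      using 2 by (subst distr_distr) (auto simp: comp_def)
    then show ?thesis using 2 d by (intro that[of \<sigma>]) auto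
  qed
qed

text \<open>After scaling, this is the characteristic function of the standard normal law at
  \<open>\<sigma>\<close>, whose imaginary part vanishes; \<open>\<sigma>\<close> squared is then
  recognised as the second moment.\<close>

lemma centered_gaussian_rv_cos:
  assumes "prob_space M" and Z: "gaussian_rv M Z" and mean: "(LINT \<omega>|M. Z \<omega>) = 0"
  shows "integrable M (\<lambda>\<omega>. (Z \<omega>)\<^sup>2)"
    and "(LINT \<omega>|M. cos (Z \<omega> + b)) = cos b * exp (- (LINT \<omega>|M. (Z \<omega>)\<^sup>2) / 2)"
proof -
  interpret std: real_distribution std_normal_distribution by (rule real_dist_normal_dist)
  obtain \<sigma> where d: "distr M borel Z = distr std_normal_distribution borel (\<lambda>x. \<sigma> * x)"
    using centered_gaussian_rv_distr[OF assms] by blast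
  have [measurable]: "Z \<in> borel_measurable M" using Z by (simp add: gaussian_rv_def)
  have m2: "integrable std_normal_distribution (\<lambda>x. x\<^sup>2)" "(LINT x|std_normal_distribution. x\<^sup>2) = 1"
    using std_normal_distribution_even_moments[of 1] by (simp_all add: numeral_eq_Suc)
  have "integrable (distr M borel Z) (\<lambda>x. x\<^sup>2)"
    unfolding d by (subst integrable_distr_eq) (auto simp: power_mult_distrib m2)
  then show "integrable M (\<lambda>\<omega>. (Z \<omega>)\<^sup>2)" by (subst (asm) integrable_distr_eq) auto
  have "(LINT \<omega>|M. (Z \<omega>)\<^sup>2) = (LINT x|distr M borel Z. x\<^sup>2)" by (subst integral_distr) auto
  also have "\<dots> = \<sigma>\<^sup>2" unfolding d by (subst integral_distr) (auto simp: power_mult_distrib m2)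
  finally have var: "(LINT \<omega>|M. (Z \<omega>)\<^sup>2) = \<sigma>\<^sup>2" .
  have i: "integrable std_normal_distribution (\<lambda>x. iexp (\<sigma> * x))"
    by (rule std.integrable_const_bound[of _ 1]) (auto intro!: measurable_compose[OF _ borel_measurable_continuous_onI] continuous_intros)
  have "Re (char std_normal_distribution \<sigma>) = (LINT x|std_normal_distribution. Re (iexp (\<sigma> * x)))"
       "Im (char std_normal_distribution \<sigma>) = (LINT x|std_normal_distribution. Im (iexp (\<sigma> * x)))"
    unfolding char_def using i by simp_all
  then have cs: "(LINT x|std_normal_distribution. cos (\<sigma> * x)) = exp (- \<sigma>\<^sup>2 / 2)"
      "(LINT x|std_normal_distribution. sin (\<sigma> * x)) = 0"
    unfolding char_std_normal_distribution by (simp_all add: Re_exp Im_exp)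
  have ic: "integrable std_normal_distribution (\<lambda>x. cos (\<sigma> * x))" "integrable std_normal_distribution (\<lambda>x. sin (\<sigma> * x))"
    by (rule std.integrable_const_bound[of _ 1]; simp)+
  have "(LINT \<omega>|M. cos (Z \<omega> + b)) = (LINT x|distr M borel Z. cos (x + b))" by (subst integral_distr) auto
  also have "\<dots> = (LINT x|std_normal_distribution. cos (\<sigma> * x) * cos b - sin (\<sigma> * x) * sin b)"
    unfolding d by (subst integral_distr) (auto simp: cos_add)
  also have "\<dots> = cos b * exp (- \<sigma>\<^sup>2 / 2)"
    by (simp add: ic cs)
  finally show "(LINT \<omega>|M. cos (Z \<omega> + b)) = cos b * exp (- (LINT \<omega>|M. (Z \<omega>)\<^sup>2) / 2)"
    by (simp add: var)
qed

section \<open>Centered Gaussian vectors\<close>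

text \<open>Linear growth is chosen because products with a coordinate then grow quadratically and
  are integrable by second moments alone. The partial derivatives are an explicit argument so that
  they can be handed to integration by parts.\<close>

definition has_tame_gradient :: "(real ^ 'n \<Rightarrow> real) \<Rightarrow> ('n \<Rightarrow> real ^ 'n \<Rightarrow> real) \<Rightarrow> bool" where
  "has_tame_gradient G G' \<longleftrightarrow>
     (\<forall>x. (G has_derivative (\<lambda>h. \<Sum>j\<in>UNIV. G' j x * h $ j)) (at x)) \<and>
     (\<forall>j. continuous_on UNIV (G' j)) \<and>
     (\<exists>C. \<forall>x. \<bar>G x\<bar> \<le> C * (1 + norm x) \<and> (\<forall>j. \<bar>G' j x\<bar> \<le> C * (1 + norm x)))"

lemma borel_measurable_vec_nth [measurable]: "(\<lambda>x :: real ^ 'n. x $ k) \<in> borel_measurable borel"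
  by (intro borel_measurable_continuous_onI continuous_intros)

section \<open>Second moments, cosine transforms and independence for one Gaussian vector\<close>

locale centered_gaussian = prob_space M for M :: "'a measure" +
  fixes X :: "'a \<Rightarrow> real ^ 'n"
  assumes centered_gaussian: "centered_gaussian_vector M X"
begin

lemma measurable_X [measurable]: "X \<in> borel_measurable M"
  using centered_gaussian by (simp add: centered_gaussian_vector_def gaussian_vector_def)

lemma gaussian_inner: "gaussian_rv M (\<lambda>\<omega>. u \<bullet> X \<omega>)"
  using centered_gaussian by (simp add: centered_gaussian_vector_def gaussian_vector_def)

lemma expectation_nth: "expectation (\<lambda>\<omega>. X \<omega> $ i) = 0"
  using centered_gaussian by (simp add: centered_gaussian_vector_def)

lemma integrable_nth_power2: "integrable M (\<lambda>\<omega>. (X \<omega> $ i)\<^sup>2)"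
  using centered_gaussian_rv_cos(1)[OF prob_space_axioms gaussian_inner[of "axis i 1"]] expectation_nth[of i]
  by (simp add: inner_axis')

lemma integrable_nth: "integrable M (\<lambda>\<omega>. X \<omega> $ i)"
  by (rule square_integrable_imp_integrable) (auto intro: integrable_nth_power2)

lemma integrable_norm_power2: "integrable M (\<lambda>\<omega>. (norm (X \<omega>))\<^sup>2)"
  unfolding power2_norm_eq_inner inner_vec_def
  by (auto simp: power2_eq_square[symmetric] intro!: integrable_nth_power2)

lemma integrable_norm: "integrable M (\<lambda>\<omega>. norm (X \<omega>))"
  by (rule square_integrable_imp_integrable) (auto intro: integrable_norm_power2)

lemma integrable_nth_mult: "integrable M (\<lambda>\<omega>. X \<omega> $ i * X \<omega> $ j)"
proof (rule Bochner_Integration.integrable_bound[OF integrable_norm_power2], measurable, rule AE_I2)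
  show "norm (X \<omega> $ i * X \<omega> $ j) \<le> norm ((norm (X \<omega>))\<^sup>2)" for \<omega>
    by (simp add: abs_mult power2_eq_square mult_mono component_le_norm_cart)
qed

lemma expectation_inner: "expectation (\<lambda>\<omega>. u \<bullet> X \<omega>) = 0"
  by (simp add: inner_vec_def integrable_nth expectation_nth)

lemma integrable_inner_mult: "integrable M (\<lambda>\<omega>. (u \<bullet> X \<omega>) * (v \<bullet> X \<omega>))"
  by (simp add: inner_vec_def sum_product algebra_simps integrable_nth_mult)

lemma expectation_cos:
  "expectation (\<lambda>\<omega>. cos (u \<bullet> X \<omega> + b)) = cos b * exp (- expectation (\<lambda>\<omega>. (u \<bullet> X \<omega>)\<^sup>2) / 2)"
  by (rule centered_gaussian_rv_cos(2)[OF prob_space_axioms gaussian_inner expectation_inner])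

text \<open>Product-to-sum leaves the directions \<open>u + v\<close> and \<open>u - v\<close>.
  Without correlation both have as variance the sum of the two variances, so the exponential
  factorises.\<close>

lemma expectation_cos_mult_cos:
  assumes "expectation (\<lambda>\<omega>. (u \<bullet> X \<omega>) * (v \<bullet> X \<omega>)) = 0"
  shows "expectation (\<lambda>\<omega>. cos (u \<bullet> X \<omega> + b) * cos (v \<bullet> X \<omega> + b')) =
    expectation (\<lambda>\<omega>. cos (u \<bullet> X \<omega> + b)) * expectation (\<lambda>\<omega>. cos (v \<bullet> X \<omega> + b'))"
proof -
  note i = integrable_inner_mult[of u u] integrable_inner_mult[of v v] integrable_inner_mult[of u v]
  have v1: "expectation (\<lambda>\<omega>. ((u + v) \<bullet> X \<omega>)\<^sup>2) = expectation (\<lambda>\<omega>. (u \<bullet> X \<omega>)\<^sup>2) + expectation (\<lambda>\<omega>. (v \<bullet> X \<omega>)\<^sup>2)"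
  proof -
    have "((u + v) \<bullet> X \<omega>)\<^sup>2 = (u \<bullet> X \<omega>)\<^sup>2 + 2 * ((u \<bullet> X \<omega>) * (v \<bullet> X \<omega>)) + (v \<bullet> X \<omega>)\<^sup>2" for \<omega>
      by (simp add: inner_add_left power2_eq_square algebra_simps)
    then show ?thesis using i assms by (simp add: power2_eq_square[symmetric])
  qed
  have v2: "expectation (\<lambda>\<omega>. ((u - v) \<bullet> X \<omega>)\<^sup>2) = expectation (\<lambda>\<omega>. (u \<bullet> X \<omega>)\<^sup>2) + expectation (\<lambda>\<omega>. (v \<bullet> X \<omega>)\<^sup>2)"
  proof -
    have "((u - v) \<bullet> X \<omega>)\<^sup>2 = (u \<bullet> X \<omega>)\<^sup>2 - 2 * ((u \<bullet> X \<omega>) * (v \<bullet> X \<omega>)) + (v \<bullet> X \<omega>)\<^sup>2" for \<omega>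
      by (simp add: inner_diff_left power2_eq_square algebra_simps)
    then show ?thesis using i assms by (simp add: power2_eq_square[symmetric])
  qed
  have ic: "integrable M (\<lambda>\<omega>. cos (w \<bullet> X \<omega> + d))" for w d
    by (rule integrable_const_bound[of _ 1]) auto
  have pf: "cos (u \<bullet> X \<omega> + b) * cos (v \<bullet> X \<omega> + b') =
      (cos ((u + v) \<bullet> X \<omega> + (b + b')) + cos ((u - v) \<bullet> X \<omega> + (b - b'))) / 2" for \<omega>
  proof -
    have "cos s * cos t = (cos (s + t) + cos (s - t)) / 2" for s t :: real
      by (simp add: cos_add cos_diff)
    from this[of "u \<bullet> X \<omega> + b" "v \<bullet> X \<omega> + b'"] show ?thesis
      by (simp add: inner_add_left inner_diff_left algebra_simps)
  qed
  have "expectation (\<lambda>\<omega>. cos (u \<bullet> X \<omega> + b) * cos (v \<bullet> X \<omega> + b')) =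
     (expectation (\<lambda>\<omega>. cos ((u + v) \<bullet> X \<omega> + (b + b'))) + expectation (\<lambda>\<omega>. cos ((u - v) \<bullet> X \<omega> + (b - b')))) / 2"
    unfolding pf by (simp add: ic)
  also have "\<dots> = expectation (\<lambda>\<omega>. cos (u \<bullet> X \<omega> + b)) * expectation (\<lambda>\<omega>. cos (v \<bullet> X \<omega> + b'))"
  proof -
    have e: "exp (- (x + y) / 2) = exp (- x / 2) * exp (- y / 2)" for x y :: real
      by (simp add: exp_add[symmetric] diff_divide_distrib)
    have c: "(cos (b + b') * r + cos (b - b') * r) / 2 = cos b * cos b' * r" for r
      by (simp add: cos_add cos_diff algebra_simps)
    show ?thesis unfolding expectation_cos v1 v2 c e by (simp only: mult_ac)
  qed
  finally show ?thesis .
qed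

text \<open>Uncorrelated linear images of a Gaussian vector are independent. The factorisation of
  cosine transforms is turned into one of laws in two stages: first sets for
  \<open>X \<omega> $ i\<close> with frequencies for \<open>R\<close>, then sets for both.\<close>

lemma distr_decorrelated:
  fixes c :: "real ^ 'n" and i :: 'n
  defines "R \<equiv> \<lambda>\<omega>. X \<omega> - X \<omega> $ i *\<^sub>R c"
  assumes uncor: "\<And>j. expectation (\<lambda>\<omega>. X \<omega> $ i * R \<omega> $ j) = 0"
  shows "distr M borel (\<lambda>\<omega>. X \<omega> $ i) \<Otimes>\<^sub>M distr M borel R = distr M (borel \<Otimes>\<^sub>M borel) (\<lambda>\<omega>. (X \<omega> $ i, R \<omega>))"
proof -
  have [measurable]: "R \<in> borel_measurable M" unfolding R_def by measurable
  have ind: "expectation (\<lambda>\<omega>. cos (v \<bullet> R \<omega> + b) * indicator A (X \<omega> $ i)) = expectation (\<lambda>\<omega>. cos (v \<bullet> R \<omega> + b)) * prob {\<omega>\<in>space M. X \<omega> $ i \<in> A}"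
    if [measurable]: "A \<in> sets borel" for v b A
  proof -
    \<comment> \<open>Removing the component along \<open>axis i 1\<close> makes \<open>w\<close>
      the direction that represents \<open>v \<bullet> R \<omega>\<close> as a functional of
      \<open>X \<omega>\<close>.\<close>
    define w where "w = v - (v \<bullet> c) *\<^sub>R axis i 1"
    have vR: "v \<bullet> R \<omega> = w \<bullet> X \<omega>" for \<omega>
      by (simp add: R_def w_def inner_diff_left inner_diff_right inner_axis')
    have S: "X \<omega> $ i = axis i 1 \<bullet> X \<omega>" for \<omega> by (simp add: inner_axis')
    have iR: "integrable M (\<lambda>\<omega>. X \<omega> $ i * R \<omega> $ j)" for j
    proof -
      have "X \<omega> $ i * R \<omega> $ j = X \<omega> $ i * X \<omega> $ j - c $ j * (X \<omega> $ i * X \<omega> $ i)" for \<omega>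
        by (simp add: R_def algebra_simps)
      then show ?thesis by (simp add: integrable_nth_mult)
    qed
    have "expectation (\<lambda>\<omega>. X \<omega> $ i * (v \<bullet> R \<omega>)) = expectation (\<lambda>\<omega>. \<Sum>j\<in>UNIV. v $ j * (X \<omega> $ i * R \<omega> $ j))"
      by (simp add: inner_vec_def sum_distrib_left mult_ac)
    also have "\<dots> = 0" using iR uncor by simp
    finally have u0: "expectation (\<lambda>\<omega>. (w \<bullet> X \<omega>) * ((s *\<^sub>R axis i 1) \<bullet> X \<omega>)) = 0" for s
      unfolding vR by (simp add: inner_axis' mult_ac)
    have fac: "expectation (\<lambda>\<omega>. cos (v \<bullet> R \<omega> + b) * cos (s * X \<omega> $ i + b')) = expectation (\<lambda>\<omega>. cos (v \<bullet> R \<omega> + b)) * expectation (\<lambda>\<omega>. cos (s * X \<omega> $ i + b'))" for s b'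
      using expectation_cos_mult_cos[OF u0, of b s b'] by (simp add: vR inner_axis')
    define K where "K = expectation (\<lambda>\<omega>. 1 + cos (v \<bullet> R \<omega> + b))"
    have ib: "integrable M h" if "h \<in> borel_measurable M" "\<And>x. \<bar>h x\<bar> \<le> 1" for h :: "'a \<Rightarrow> real"
      using that by (intro integrable_const_bound[of _ 1]) auto
    have cb: "integrable M (\<lambda>\<omega>. cos (v \<bullet> R \<omega> + b))" by (rule ib) auto
    then have K: "K = 1 + expectation (\<lambda>\<omega>. cos (v \<bullet> R \<omega> + b))" by (simp add: K_def prob_space)
    have c1: "0 \<le> 1 + cos y" "1 + cos y \<le> 2" for y :: real
      using cos_ge_minus_one[of y] cos_le_one[of y] by linarith+
    have "0 \<le> K" unfolding K_def by (intro Bochner_Integration.integral_nonneg c1)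
    moreover have "K \<le> expectation (\<lambda>\<omega>. 2)" unfolding K_def using cb by (intro Bochner_Integration.integral_mono c1) auto
    ultimately have K02: "0 \<le> K" "K \<le> 2" by (simp_all add: prob_space)
    \<comment> \<open>By the factorisation, the weight \<open>1 + cos\<close> can be replaced by its
      mean \<open>K\<close> when tested against functions of \<open>X \<omega> $ i\<close>; the
      added \<open>1\<close> keeps the weight nonnegative.\<close>
    have e1: "expectation (\<lambda>\<omega>. (1 + cos (v \<bullet> R \<omega> + b)) * indicator A (X \<omega> $ i)) = expectation (\<lambda>\<omega>. K * indicator A (X \<omega> $ i))"
    proof (rule integral_indicator_eqI_cos[where C = 2])
      fix s b'
      have "integrable M (\<lambda>\<omega>. cos (v \<bullet> R \<omega> + b) * cos (s * X \<omega> $ i + b'))"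
        by (rule ib) (simp_all add: abs_mult mult_le_one)
      moreover have "integrable M (\<lambda>\<omega>. cos (s * X \<omega> $ i + b'))" by (rule ib) simp_all
      ultimately show "expectation (\<lambda>\<omega>. (1 + cos (v \<bullet> R \<omega> + b)) * cos (s * X \<omega> $ i + b')) = expectation (\<lambda>\<omega>. K * cos (s * X \<omega> $ i + b'))"
        by (simp add: distrib_right K fac)
    qed (simp_all add: c1 K02 finite_measure_axioms)
    have iA: "integrable M (\<lambda>\<omega>. indicator A (X \<omega> $ i) :: real)"
      by (rule ib) (simp_all add: indicator_def)
    have icA: "integrable M (\<lambda>\<omega>. cos (v \<bullet> R \<omega> + b) * indicator A (X \<omega> $ i))"
      by (rule ib) (simp_all add: indicator_def)
    have "expectation (\<lambda>\<omega>. indicator A (X \<omega> $ i)) = expectation (indicator {\<omega>\<in>space M. X \<omega> $ i \<in> A} :: _ \<Rightarrow> real)"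
      by (intro Bochner_Integration.integral_cong) (simp_all add: indicator_def)
    then have e2: "expectation (\<lambda>\<omega>. indicator A (X \<omega> $ i) :: real) = prob {\<omega>\<in>space M. X \<omega> $ i \<in> A}"
      by simp
    have "expectation (\<lambda>\<omega>. (1 + cos (v \<bullet> R \<omega> + b)) * indicator A (X \<omega> $ i)) =
       prob {\<omega>\<in>space M. X \<omega> $ i \<in> A} + expectation (\<lambda>\<omega>. cos (v \<bullet> R \<omega> + b) * indicator A (X \<omega> $ i))"
      unfolding distrib_right mult_1 e2[symmetric] by (rule Bochner_Integration.integral_add[OF iA icA])
    moreover have "expectation (\<lambda>\<omega>. K * indicator A (X \<omega> $ i)) = K * prob {\<omega>\<in>space M. X \<omega> $ i \<in> A}"
      unfolding e2[symmetric] by simp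
    ultimately show ?thesis
      unfolding e1 K by (simp only: distrib_right mult_1)
  qed
  show ?thesis
  proof (rule pair_measure_eqI)
    fix A B assume "A \<in> sets (distr M borel (\<lambda>\<omega>. X \<omega> $ i))" "B \<in> sets (distr M borel R)"
    then have [measurable]: "A \<in> sets borel" "B \<in> sets borel" by auto
    define S where "S = {\<omega>\<in>space M. X \<omega> $ i \<in> A}"
    have [measurable]: "S \<in> sets M" unfolding S_def by measurable
    \<comment> \<open>\<open>P\<close> is the law of \<open>R\<close> restricted to the event
      \<open>S\<close>, and \<open>Q\<close> is the full law of \<open>R\<close> scaled by
      \<open>prob S\<close>; their equality for every \<open>A\<close> is independence.\<close>
    define P where "P = distr (density M (indicator S)) borel R"
    define Q where "Q = distr (density M (\<lambda>\<omega>. ennreal (prob S))) borel R"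
    have PQ: "P = Q"
    proof (rule finite_measure_eqI_cos)
      show "finite_measure P"
        unfolding P_def by (intro finite_measure.finite_measure_distr finite_measure_restricted) measurable
      have "finite_measure (density M (\<lambda>\<omega>. ennreal (prob S)))"
        by (rule finite_measureI) (simp add: emeasure_density_const emeasure_space_1)
      then show "finite_measure Q"
        unfolding Q_def by (rule finite_measure.finite_measure_distr) measurable
      fix v b
      have "(LINT x|P. cos (v \<bullet> x + b)) = (LINT \<omega>|density M (\<lambda>\<omega>. ennreal (indicator S \<omega>)). cos (v \<bullet> R \<omega> + b))"
        unfolding P_def by (subst integral_distr) (auto simp: ennreal_indicator)
      also have "\<dots> = expectation (\<lambda>\<omega>. indicator S \<omega> * cos (v \<bullet> R \<omega> + b))"
        by (subst integral_density) auto
      also have "\<dots> = expectation (\<lambda>\<omega>. cos (v \<bullet> R \<omega> + b) * indicator A (X \<omega> $ i))"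
        by (intro Bochner_Integration.integral_cong) (auto simp: S_def split: split_indicator)
      also have "\<dots> = expectation (\<lambda>\<omega>. prob S * cos (v \<bullet> R \<omega> + b))"
        by (subst ind) (auto simp: S_def)
      also have "\<dots> = (LINT \<omega>|density M (\<lambda>\<omega>. ennreal (prob S)). cos (v \<bullet> R \<omega> + b))"
        by (subst integral_density) auto
      also have "\<dots> = (LINT x|Q. cos (v \<bullet> x + b))"
        unfolding Q_def by (subst integral_distr) auto
      finally show "(LINT x|P. cos (v \<bullet> x + b)) = (LINT x|Q. cos (v \<bullet> x + b))" .
    qed (auto simp: P_def Q_def)
    have "emeasure P B = emeasure M (S \<inter> (R -` B \<inter> space M))"
      unfolding P_def by (subst emeasure_distr) (auto intro!: emeasure_restricted)
    also have "S \<inter> (R -` B \<inter> space M) = (\<lambda>\<omega>. (X \<omega> $ i, R \<omega>)) -` (A \<times> B) \<inter> space M"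
      by (auto simp: S_def)
    also have "emeasure M \<dots> = emeasure (distr M (borel \<Otimes>\<^sub>M borel) (\<lambda>\<omega>. (X \<omega> $ i, R \<omega>))) (A \<times> B)"
      by (subst emeasure_distr) auto
    finally have P: "emeasure P B = \<dots>" .
    have "emeasure Q B = ennreal (prob S) * emeasure M (R -` B \<inter> space M)"
      unfolding Q_def by (subst emeasure_distr) (auto simp: emeasure_density_const)
    also have "\<dots> = emeasure M ((\<lambda>\<omega>. X \<omega> $ i) -` A \<inter> space M) * emeasure M (R -` B \<inter> space M)"
      by (simp add: S_def vimage_def Int_def conj_commute emeasure_eq_measure)
    also have "\<dots> = emeasure (distr M borel (\<lambda>\<omega>. X \<omega> $ i)) A * emeasure (distr M borel R) B"
      by (simp add: emeasure_distr)
    finally show "emeasure (distr M borel (\<lambda>\<omega>. X \<omega> $ i)) A * emeasure (distr M borel R) B =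
        emeasure (distr M (borel \<Otimes>\<^sub>M borel) (\<lambda>\<omega>. (X \<omega> $ i, R \<omega>))) (A \<times> B)"
      using P PQ by simp
  qed (auto intro!: finite_measure.sigma_finite_measure prob_space.finite_measure prob_space_distr)
qed

end

section \<open>Gaussian integration by parts\<close>

lemma has_tame_gradientD:
  assumes "has_tame_gradient G G'"
  shows has_tame_gradient_derivative: "(G has_derivative (\<lambda>h. \<Sum>j\<in>UNIV. G' j x * h $ j)) (at x)"
    and has_tame_gradient_continuous: "continuous_on UNIV G"
    and has_tame_gradient_continuous': "continuous_on UNIV (G' j)"
    and has_tame_gradient_measurable: "G \<in> borel_measurable borel"
    and has_tame_gradient_measurable': "G' j \<in> borel_measurable borel"
proof -
  show d: "(G has_derivative (\<lambda>h. \<Sum>j\<in>UNIV. G' j x * h $ j)) (at x)" for x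
    using assms by (auto simp: has_tame_gradient_def)
  show c: "continuous_on UNIV G"
    by (meson d has_derivative_continuous continuous_at_imp_continuous_on)
  show c': "continuous_on UNIV (G' j)"
    using assms by (auto simp: has_tame_gradient_def)
  show "G \<in> borel_measurable borel" "G' j \<in> borel_measurable borel"
    using c c' by (auto intro: borel_measurable_continuous_onI)
qed

lemma has_tame_gradient_bound:
  assumes "has_tame_gradient G G'"
  obtains C where "0 \<le> C" "\<And>x. \<bar>G x\<bar> \<le> C * (1 + norm x)" "\<And>j x. \<bar>G' j x\<bar> \<le> C * (1 + norm x)"
proof -
  obtain C where C: "\<And>x. \<bar>G x\<bar> \<le> C * (1 + norm x)" "\<And>j x. \<bar>G' j x\<bar> \<le> C * (1 + norm x)"
    using assms unfolding has_tame_gradient_def by blast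
  moreover have "0 \<le> C" using C(1)[of 0] by (simp add: order_trans[OF abs_ge_zero])
  ultimately show ?thesis using that by blast
qed

text \<open>Serves two purposes: freezing one of two independent vectors (\<open>z\<close> is then
  its contribution), and the shift by \<open>\<mu>\<close>.\<close>

lemma has_tame_gradient_affine:
  assumes G: "has_tame_gradient G G'"
  shows "has_tame_gradient (\<lambda>x. G (a *\<^sub>R x + z)) (\<lambda>j x. a * G' j (a *\<^sub>R x + z))"
proof -
  obtain C where C: "0 \<le> C" "\<And>x. \<bar>G x\<bar> \<le> C * (1 + norm x)" "\<And>j x. \<bar>G' j x\<bar> \<le> C * (1 + norm x)"
    using has_tame_gradient_bound[OF G] by blast
  have bnd: "1 + norm (a *\<^sub>R x + z) \<le> (1 + \<bar>a\<bar> + norm z) * (1 + norm x)" for x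
  proof -
    have "(1 + \<bar>a\<bar> + norm z) * (1 + norm x) = 1 + (\<bar>a\<bar> * norm x + norm z) + (\<bar>a\<bar> + norm x + norm z * norm x)"
      by (simp add: algebra_simps)
    moreover have "0 \<le> \<bar>a\<bar> + norm x + norm z * norm x" by simp
    ultimately show ?thesis using norm_triangle_ineq[of "a *\<^sub>R x" z] unfolding norm_scaleR by linarith
  qed
  define C' where "C' = C * (1 + \<bar>a\<bar> + norm z)"
  have C': "0 \<le> C'" "C * (1 + norm (a *\<^sub>R x + z)) \<le> C' * (1 + norm x)" for x
    using C(1) mult_left_mono[OF bnd C(1), of x] by (auto simp: C'_def mult.assoc)
  have der: "((\<lambda>x. G (a *\<^sub>R x + z)) has_derivative (\<lambda>h. \<Sum>j\<in>UNIV. a * G' j (a *\<^sub>R x + z) * h $ j)) (at x)" for x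
  proof -
    have 1: "((\<lambda>x. a *\<^sub>R x + z) has_derivative (\<lambda>h. a *\<^sub>R h)) (at x)"
      by (auto intro!: derivative_eq_intros)
    have "((\<lambda>x. G (a *\<^sub>R x + z)) has_derivative (\<lambda>h. \<Sum>j\<in>UNIV. G' j (a *\<^sub>R x + z) * (a *\<^sub>R h) $ j)) (at x)"
      by (rule has_derivative_compose[OF 1 has_tame_gradient_derivative[OF G]])
    then show ?thesis by (simp add: mult_ac)
  qed
  have cont: "continuous_on UNIV (\<lambda>x. a * G' j (a *\<^sub>R x + z))" for j
    by (intro continuous_intros continuous_on_compose2[OF has_tame_gradient_continuous'[OF G]]) auto
  \<comment> \<open>The factor \<open>1 + \<bar>a\<bar>\<close> dominates both \<open>1\<close> and
    \<open>\<bar>a\<bar>\<close>, so one constant serves the function and its partial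
    derivatives.\<close>
  have "\<bar>G (a *\<^sub>R x + z)\<bar> \<le> ((1 + \<bar>a\<bar>) * C') * (1 + norm x)" for x
  proof -
    have "\<bar>G (a *\<^sub>R x + z)\<bar> \<le> 1 * (C' * (1 + norm x))" using C(2) C'(2) by (metis order_trans mult_1)
    also have "\<dots> \<le> (1 + \<bar>a\<bar>) * (C' * (1 + norm x))" using C' by (intro mult_right_mono) auto
    finally show ?thesis by (simp only: mult.assoc)
  qed
  moreover have "\<bar>a * G' j (a *\<^sub>R x + z)\<bar> \<le> ((1 + \<bar>a\<bar>) * C') * (1 + norm x)" for j x
  proof -
    have "\<bar>G' j (a *\<^sub>R x + z)\<bar> \<le> C' * (1 + norm x)" using C(3) C'(2) by (metis order_trans)
    then have "\<bar>a\<bar> * \<bar>G' j (a *\<^sub>R x + z)\<bar> \<le> (1 + \<bar>a\<bar>) * (C' * (1 + norm x))" by (intro mult_mono) auto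
    then show ?thesis by (simp only: abs_mult mult.assoc)
  qed
  ultimately show ?thesis
    unfolding has_tame_gradient_def using der cont by blast
qed

section \<open>Integrability and the multivariate integration by parts formula\<close>

context centered_gaussian
begin

lemma integrable_quadratic_growth:
  fixes h :: "'a \<Rightarrow> real"
  assumes [measurable]: "h \<in> borel_measurable M" and h: "\<And>\<omega>. \<bar>h \<omega>\<bar> \<le> C * (1 + norm (X \<omega>))\<^sup>2"
  shows "integrable M h"
proof -
  have "(1 + norm (X \<omega>))\<^sup>2 = 1 + 2 * norm (X \<omega>) + (norm (X \<omega>))\<^sup>2" for \<omega>
    by (simp add: power2_eq_square algebra_simps)
  then have "integrable M (\<lambda>\<omega>. C * (1 + norm (X \<omega>))\<^sup>2)"
    by (simp add: integrable_norm integrable_norm_power2)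
  then show ?thesis
    by (rule Bochner_Integration.integrable_bound) (auto intro!: order_trans[OF h])
qed

lemma integrable_nth_mult_tame:
  assumes G: "has_tame_gradient G G'"
  shows "integrable M (\<lambda>\<omega>. X \<omega> $ i * G (X \<omega>))" and "integrable M (\<lambda>\<omega>. G (X \<omega>))"
    and "integrable M (\<lambda>\<omega>. G' j (X \<omega>))"
proof -
  obtain C where C: "0 \<le> C" "\<And>x. \<bar>G x\<bar> \<le> C * (1 + norm x)" "\<And>j x. \<bar>G' j x\<bar> \<le> C * (1 + norm x)"
    using has_tame_gradient_bound[OF G] by blast
  note [measurable] = has_tame_gradient_measurable[OF G] has_tame_gradient_measurable'[OF G]
  have le: "C * (1 + norm x) \<le> C * (1 + norm x)\<^sup>2" for x :: "real^'n"
    using C(1) by (intro mult_left_mono self_le_power) auto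
  show "integrable M (\<lambda>\<omega>. G (X \<omega>))"
    by (rule integrable_quadratic_growth[OF _ order_trans[OF C(2) le]]) measurable
  show "integrable M (\<lambda>\<omega>. G' j (X \<omega>))"
    by (rule integrable_quadratic_growth[OF _ order_trans[OF C(3) le]]) measurable
  show "integrable M (\<lambda>\<omega>. X \<omega> $ i * G (X \<omega>))"
  proof (rule integrable_quadratic_growth)
    fix \<omega>
    have "\<bar>X \<omega> $ i\<bar> * \<bar>G (X \<omega>)\<bar> \<le> (1 + norm (X \<omega>)) * (C * (1 + norm (X \<omega>)))"
      using C(1) by (intro mult_mono C) (auto intro: order_trans[OF component_le_norm_cart])
    then show "\<bar>X \<omega> $ i * G (X \<omega>)\<bar> \<le> C * (1 + norm (X \<omega>))\<^sup>2"
      by (simp add: abs_mult power2_eq_square mult_ac)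
  qed measurable
qed

text \<open>
  Regression on \<open>X\<^sub>i\<close>: the remainder \<open>R = X - X\<^sub>i c\<close> is independent of \<open>X\<^sub>i\<close>, so that the one-dimensional
  formula applies for fixed \<open>R\<close>. If \<open>X\<^sub>i\<close> vanishes almost surely, then \<open>c = 0\<close> because division by zero gives \<open>0\<close>.
\<close>

theorem gaussian_integration_by_parts:
  assumes G: "has_tame_gradient G G'"
  shows "expectation (\<lambda>\<omega>. X \<omega> $ i * G (X \<omega>)) =
    (\<Sum>j\<in>UNIV. expectation (\<lambda>\<omega>. X \<omega> $ i * X \<omega> $ j) * expectation (\<lambda>\<omega>. G' j (X \<omega>)))"
proof -
  interpret std: real_distribution std_normal_distribution by (rule real_dist_normal_dist)
  note [measurable] = has_tame_gradient_measurable[OF G] has_tame_gradient_measurable'[OF G]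
  have "gaussian_rv M (\<lambda>\<omega>. X \<omega> $ i)" using gaussian_inner[of "axis i 1"] by (simp add: inner_axis')
  then obtain \<sigma> where \<sigma>: "distr M borel (\<lambda>\<omega>. X \<omega> $ i) = distr std_normal_distribution borel (\<lambda>x. \<sigma> * x)"
    using centered_gaussian_rv_distr[OF prob_space_axioms _ expectation_nth] by metis
  define cov where "cov j = expectation (\<lambda>\<omega>. X \<omega> $ i * X \<omega> $ j)" for j
  have var: "cov i = \<sigma>\<^sup>2"
  proof -
    have "cov i = (LINT s|distr M borel (\<lambda>\<omega>. X \<omega> $ i). s\<^sup>2)"
      unfolding cov_def by (subst integral_distr) (auto simp: power2_eq_square)
    also have "\<dots> = (LINT x|std_normal_distribution. \<sigma>\<^sup>2 * x\<^sup>2)"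
      unfolding \<sigma> by (subst integral_distr) (auto simp: power_mult_distrib)
    also have "\<dots> = \<sigma>\<^sup>2"
      using std_normal_distribution_even_moments(1)[of 1] by (simp add: numeral_eq_Suc)
    finally show ?thesis .
  qed
  define c where "c = (\<chi> j. cov j / \<sigma>\<^sup>2)"
  \<comment> \<open>In the degenerate case both sides are zero, since an almost surely vanishing
    coordinate has no covariance with any other.\<close>
  have c: "\<sigma>\<^sup>2 * c $ j = cov j" for j
  proof (cases "\<sigma> = 0")
    case True
    then have "expectation (\<lambda>\<omega>. (X \<omega> $ i)\<^sup>2) = 0" using var by (simp add: cov_def power2_eq_square)
    then have "AE \<omega> in M. (X \<omega> $ i)\<^sup>2 = 0"
      by (subst (asm) integral_nonneg_eq_0_iff_AE) (auto intro: integrable_nth_power2)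
    then have "AE \<omega> in M. X \<omega> $ i * X \<omega> $ j = 0" by eventually_elim auto
    then have "cov j = 0" unfolding cov_def by (rule integral_eq_zero_AE)
    then show ?thesis using True by simp
  qed (simp add: c_def)
  define R where "R \<omega> = X \<omega> - X \<omega> $ i *\<^sub>R c" for \<omega>
  have [measurable]: "R \<in> borel_measurable M" unfolding R_def by measurable
  define S where "S = distr M borel (\<lambda>\<omega>. X \<omega> $ i)"
  define L where "L = distr M borel R"
  have "expectation (\<lambda>\<omega>. X \<omega> $ i * R \<omega> $ j) = 0" for j
  proof -
    have "X \<omega> $ i * R \<omega> $ j = X \<omega> $ i * X \<omega> $ j - c $ j * (X \<omega> $ i * X \<omega> $ i)" for \<omega>
      by (simp add: R_def algebra_simps)
    then have "expectation (\<lambda>\<omega>. X \<omega> $ i * R \<omega> $ j) = cov j - c $ j * cov i"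
      by (simp add: integrable_nth_mult cov_def)
    then show ?thesis using c[of j] var by (simp add: mult.commute)
  qed
  then have joint: "S \<Otimes>\<^sub>M L = distr M (borel \<Otimes>\<^sub>M borel) (\<lambda>\<omega>. (X \<omega> $ i, R \<omega>))"
    unfolding S_def L_def R_def by (intro distr_decorrelated)
  interpret S: prob_space S unfolding S_def by (rule prob_space_distr) measurable
  interpret L: prob_space L unfolding L_def by (rule prob_space_distr) measurable
  interpret SL: pair_prob_space S L ..
  have XR: "X \<omega> $ i *\<^sub>R c + R \<omega> = X \<omega>" for \<omega> by (simp add: R_def)
  \<comment> \<open>By independence, an expectation involving \<open>X \<omega> $ i\<close> and
    \<open>X \<omega>\<close> is an iterated integral over the coordinate \<open>s\<close> and the
    remainder \<open>r\<close>.\<close>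
  have push: "integrable (S \<Otimes>\<^sub>M L) (\<lambda>(s, r). h s (s *\<^sub>R c + r)) \<and>
       (LINT r|L. (LINT s|S. h s (s *\<^sub>R c + r))) = expectation (\<lambda>\<omega>. h (X \<omega> $ i) (X \<omega>))"
    if [measurable]: "(\<lambda>(s, x). h s x) \<in> borel_measurable (borel \<Otimes>\<^sub>M borel)"
      and int: "integrable M (\<lambda>\<omega>. h (X \<omega> $ i) (X \<omega>))" for h :: "real \<Rightarrow> real ^ 'n \<Rightarrow> real"
  proof -
    have [measurable]: "(\<lambda>(s, r). h s (s *\<^sub>R c + r)) \<in> borel_measurable (borel \<Otimes>\<^sub>M borel)"
      by measurable
    have i: "integrable (S \<Otimes>\<^sub>M L) (\<lambda>(s, r). h s (s *\<^sub>R c + r))"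
      unfolding joint by (subst integrable_distr_eq) (use int in \<open>auto simp: XR\<close>)
    have "(LINT r|L. (LINT s|S. h s (s *\<^sub>R c + r))) = (LINT p|(S \<Otimes>\<^sub>M L). (case p of (s, r) \<Rightarrow> h s (s *\<^sub>R c + r)))"
      by (rule SL.integral_snd[OF i])
    also have "\<dots> = expectation (\<lambda>\<omega>. h (X \<omega> $ i) (X \<omega>))"
      unfolding joint by (subst integral_distr) (auto simp: XR)
    finally show ?thesis using i by simp
  qed
  have inner: "(LINT s|S. s * G (s *\<^sub>R c + r)) = (LINT s|S. (\<Sum>j\<in>UNIV. cov j * G' j (s *\<^sub>R c + r)))" for r
  proof -
    define \<psi> where "\<psi> x = G ((\<sigma> * x) *\<^sub>R c + r)" for x
    define \<psi>' where "\<psi>' x = (\<Sum>j\<in>UNIV. G' j ((\<sigma> * x) *\<^sub>R c + r) * (\<sigma> * c $ j))" for x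
    obtain C where C: "0 \<le> C" "\<And>x. \<bar>G x\<bar> \<le> C * (1 + norm x)" "\<And>j x. \<bar>G' j x\<bar> \<le> C * (1 + norm x)"
      using has_tame_gradient_bound[OF G] by blast
    define K where "K = 1 + (\<Sum>j\<in>UNIV. \<bar>\<sigma> * c $ j\<bar>)"
    have K: "1 \<le> K" "(\<Sum>j\<in>UNIV. \<bar>\<sigma> * c $ j\<bar>) \<le> K" by (auto simp: K_def intro!: sum_nonneg)
    define A where "A = C * (1 + \<bar>\<sigma>\<bar> * norm c + norm r)"
    have A: "C * (1 + norm ((\<sigma> * x) *\<^sub>R c + r)) \<le> A * (1 + \<bar>x\<bar>)" for x
    proof -
      have "1 + norm ((\<sigma> * x) *\<^sub>R c + r) \<le> (1 + \<bar>\<sigma>\<bar> * norm c + norm r) * (1 + \<bar>x\<bar>)"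
      proof -
        have "(1 + \<bar>\<sigma>\<bar> * norm c + norm r) * (1 + \<bar>x\<bar>) =
            1 + (\<bar>\<sigma> * x\<bar> * norm c + norm r) + (\<bar>\<sigma>\<bar> * norm c + \<bar>x\<bar> + norm r * \<bar>x\<bar>)"
          by (simp add: algebra_simps abs_mult)
        moreover have "0 \<le> \<bar>\<sigma>\<bar> * norm c + \<bar>x\<bar> + norm r * \<bar>x\<bar>" by simp
        ultimately show ?thesis using norm_triangle_ineq[of "(\<sigma> * x) *\<^sub>R c" r] unfolding norm_scaleR by linarith
      qed
      then show ?thesis using C(1) mult_left_mono by (fastforce simp: A_def mult.assoc)
    qed
    have A0: "0 \<le> A * (1 + \<bar>x\<bar>)" for x using C(1) by (simp add: A_def)
    have ibp: "(LINT x|std_normal_distribution. x * \<psi> x) = (LINT x|std_normal_distribution. \<psi>' x)"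
    proof (rule std_normal_integration_by_parts)
      fix x :: real
      have 1: "((\<lambda>x. (\<sigma> * x) *\<^sub>R c + r) has_derivative (\<lambda>h. (\<sigma> * h) *\<^sub>R c)) (at x)"
        by (auto intro!: derivative_eq_intros)
      have "(\<psi> has_derivative (\<lambda>h. \<Sum>j\<in>UNIV. G' j ((\<sigma> * x) *\<^sub>R c + r) * ((\<sigma> * h) *\<^sub>R c) $ j)) (at x)"
        unfolding \<psi>_def by (rule has_derivative_compose[OF 1 has_tame_gradient_derivative[OF G]])
      also have "(\<lambda>h. \<Sum>j\<in>UNIV. G' j ((\<sigma> * x) *\<^sub>R c + r) * ((\<sigma> * h) *\<^sub>R c) $ j) = (*) (\<psi>' x)"
        by (simp add: \<psi>'_def sum_distrib_left sum_distrib_right mult_ac fun_eq_iff)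
      finally show "(\<psi> has_real_derivative \<psi>' x) (at x)" by (simp add: has_field_derivative_def)
      have "\<bar>\<psi> x\<bar> \<le> 1 * (A * (1 + \<bar>x\<bar>))" using C(2) A by (metis \<psi>_def order_trans mult_1)
      also have "\<dots> \<le> K * (A * (1 + \<bar>x\<bar>))" using K A0 by (intro mult_right_mono)
      finally show "\<bar>\<psi> x\<bar> \<le> (K * A) * (1 + \<bar>x\<bar>)" by (simp only: mult.assoc)
      have "\<bar>\<psi>' x\<bar> \<le> (\<Sum>j\<in>UNIV. \<bar>G' j ((\<sigma> * x) *\<^sub>R c + r)\<bar> * \<bar>\<sigma> * c $ j\<bar>)"
        unfolding \<psi>'_def by (rule order_trans[OF sum_abs]) (simp add: abs_mult)
      also have "\<dots> \<le> (\<Sum>j\<in>UNIV. (A * (1 + \<bar>x\<bar>)) * \<bar>\<sigma> * c $ j\<bar>)"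
        by (intro sum_mono mult_right_mono order_trans[OF C(3) A]) auto
      also have "\<dots> = (\<Sum>j\<in>UNIV. \<bar>\<sigma> * c $ j\<bar>) * (A * (1 + \<bar>x\<bar>))" by (simp only: sum_distrib_left mult.commute)
      also have "\<dots> \<le> K * (A * (1 + \<bar>x\<bar>))" using K A0 by (intro mult_right_mono)
      finally show "\<bar>\<psi>' x\<bar> \<le> (K * A) * (1 + \<bar>x\<bar>)" by (simp only: mult.assoc)
    next
      show "continuous_on UNIV \<psi>'"
        unfolding \<psi>'_def by (intro continuous_intros continuous_on_compose2[OF has_tame_gradient_continuous'[OF G]]) auto
    qed
    \<comment> \<open>One \<open>\<sigma>\<close> comes from the factor \<open>s\<close> and a
      second from the chain rule in \<open>\<psi>'\<close>; together with \<open>c $ j\<close> they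
      make up \<open>cov j\<close>.\<close>
    have "(LINT s|S. s * G (s *\<^sub>R c + r)) = (LINT x|std_normal_distribution. \<sigma> * (x * \<psi> x))"
      unfolding S_def \<sigma> by (subst integral_distr) (auto simp: \<psi>_def mult.assoc)
    also have "\<dots> = (LINT x|std_normal_distribution. \<sigma> * \<psi>' x)" using ibp by simp
    also have "\<dots> = (LINT x|std_normal_distribution. (\<Sum>j\<in>UNIV. cov j * G' j ((\<sigma> * x) *\<^sub>R c + r)))"
      by (simp add: \<psi>'_def sum_distrib_left c[symmetric] power2_eq_square mult_ac)
    also have "\<dots> = (LINT s|S. (\<Sum>j\<in>UNIV. cov j * G' j (s *\<^sub>R c + r)))"
      unfolding S_def \<sigma> by (subst integral_distr) auto
    finally show ?thesis .
  qed
  have "expectation (\<lambda>\<omega>. X \<omega> $ i * G (X \<omega>)) = (LINT r|L. (LINT s|S. s * G (s *\<^sub>R c + r)))"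
    using push[of "\<lambda>s x. s * G x"] integrable_nth_mult_tame(1)[OF G] by simp
  also have "\<dots> = (LINT r|L. (LINT s|S. (\<Sum>j\<in>UNIV. cov j * G' j (s *\<^sub>R c + r))))"
    by (simp add: inner)
  also have "\<dots> = expectation (\<lambda>\<omega>. \<Sum>j\<in>UNIV. cov j * G' j (X \<omega>))"
    using push[of "\<lambda>s x. \<Sum>j\<in>UNIV. cov j * G' j x"] integrable_nth_mult_tame(3)[OF G] by simp
  also have "\<dots> = (\<Sum>j\<in>UNIV. cov j * expectation (\<lambda>\<omega>. G' j (X \<omega>)))"
    using integrable_nth_mult_tame(3)[OF G] by simp
  finally show ?thesis by (simp add: cov_def)
qed

end

section \<open>Interpolation between two independent Gaussian vectors\<close>

text \<open>Dominated convergence along sequences tending to zero: since \<open>w\<close> bounds the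
  derivative for all \<open>t\<close>, the mean value inequality makes it bound the difference
  quotients as well.\<close>

lemma has_real_derivative_integral:
  fixes f f' :: "real \<Rightarrow> 'a \<Rightarrow> real"
  assumes der: "\<And>t \<omega>. ((\<lambda>t. f t \<omega>) has_real_derivative f' t \<omega>) (at t)"
    and int: "\<And>t. integrable M (f t)" and [measurable]: "f' s \<in> borel_measurable M"
    and w: "integrable M w" "\<And>t \<omega>. \<bar>f' t \<omega>\<bar> \<le> w \<omega>"
  shows "((\<lambda>t. LINT \<omega>|M. f t \<omega>) has_real_derivative (LINT \<omega>|M. f' s \<omega>)) (at s)"
  unfolding DERIV_def
proof (rule iffD1[OF LIMSEQ_SEQ_conv], intro allI impI, elim conjE)
  fix S :: "nat \<Rightarrow> real" assume S: "\<forall>n. S n \<noteq> 0" "S \<longlonglongrightarrow> 0"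
  note [measurable] = borel_measurable_integrable[OF int]
  have "(\<lambda>n. LINT \<omega>|M. (f (s + S n) \<omega> - f s \<omega>) / S n) \<longlonglongrightarrow> (LINT \<omega>|M. f' s \<omega>)"
  proof (rule integral_dominated_convergence[OF _ _ w(1)])
    show "AE \<omega> in M. (\<lambda>n. (f (s + S n) \<omega> - f s \<omega>) / S n) \<longlonglongrightarrow> f' s \<omega>"
      using der[of _ s] S unfolding DERIV_def LIMSEQ_SEQ_conv[symmetric] by auto
    show "AE \<omega> in M. norm ((f (s + S n) \<omega> - f s \<omega>) / S n) \<le> w \<omega>" for n
    proof (rule AE_I2)
      fix \<omega>
      have "norm (f (s + S n) \<omega> - f s \<omega>) \<le> w \<omega> * norm (s + S n - s)"
        by (rule field_differentiable_bound[of UNIV "\<lambda>t. f t \<omega>"]) (use der w in auto)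
      then show "norm ((f (s + S n) \<omega> - f s \<omega>) / S n) \<le> w \<omega>"
        using S(1)[rule_format, of n] by (simp add: divide_le_eq)
    qed
  qed measurable
  then show "(\<lambda>n. ((LINT \<omega>|M. f (s + S n) \<omega>) - (LINT \<omega>|M. f s \<omega>)) / S n) \<longlonglongrightarrow> (LINT \<omega>|M. f' s \<omega>)"
    using int by simp
qed

text \<open>The two vectors live on separate spaces; on the product space they become independent
  copies with unchanged laws.\<close>

locale gaussian_pair = X: centered_gaussian M X + Y: centered_gaussian N Y
  for M :: "'a measure" and X :: "'a \<Rightarrow> real ^ 'n" and N :: "'b measure" and Y :: "'b \<Rightarrow> real ^ 'n"
begin

sublocale pair_prob_space M N ..

text \<open>The coefficients \<open>cos t\<close>, \<open>sin t\<close> give the interpolating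
  vector, and \<open>- sin t\<close>, \<open>cos t\<close> its derivative in
  \<open>t\<close>.\<close>

definition mix :: "real \<Rightarrow> real \<Rightarrow> 'a \<times> 'b \<Rightarrow> real ^ 'n" where
  "mix a b p = a *\<^sub>R X (fst p) + b *\<^sub>R Y (snd p)"

lemma measurable_mix [measurable]: "mix a b \<in> borel_measurable (M \<Otimes>\<^sub>M N)"
  unfolding mix_def by measurable

text \<open>A majorant for every \<open>mix\<close> with coefficients in the unit interval around
  zero, hence uniform along the whole arc; its square is integrable.\<close>

definition size :: "'a \<times> 'b \<Rightarrow> real" where
  "size p = 1 + norm (X (fst p)) + norm (Y (snd p))"

lemma size_ge_1: "1 \<le> size p" by (simp add: size_def)

lemma norm_mix_le: "\<bar>a\<bar> \<le> 1 \<Longrightarrow> \<bar>b\<bar> \<le> 1 \<Longrightarrow> 1 + norm (mix a b p) \<le> size p"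
  unfolding mix_def size_def
  by (rule order_trans[OF add_left_mono[OF norm_triangle_ineq]])
    (auto intro!: add_mono mult_left_le_one_le)

lemma integrable_size_power2: "integrable (M \<Otimes>\<^sub>M N) (\<lambda>p. (size p)\<^sup>2)"
proof -
  have fst: "integrable (M \<Otimes>\<^sub>M N) (\<lambda>p. (norm (X (fst p)))\<^sup>2)"
    by (rule integrable_distr[OF measurable_fst])
      (use X.integrable_norm_power2 in \<open>simp add: Y.distr_pair_fst\<close>)
  have "integrable (N \<Otimes>\<^sub>M M) (\<lambda>p. (norm (Y (fst p)))\<^sup>2)"
    by (rule integrable_distr[OF measurable_fst])
      (use Y.integrable_norm_power2 in \<open>simp add: X.distr_pair_fst\<close>)
  then have snd: "integrable (M \<Otimes>\<^sub>M N) (\<lambda>p. (norm (Y (snd p)))\<^sup>2)"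
    by (subst integrable_product_swap_iff[symmetric]) (simp add: case_prod_beta')
  have "integrable (M \<Otimes>\<^sub>M N) (\<lambda>p. 3 * (1 + (norm (X (fst p)))\<^sup>2 + (norm (Y (snd p)))\<^sup>2))"
    using fst snd by simp
  then show ?thesis
  proof (rule Bochner_Integration.integrable_bound)
    show "AE p in M \<Otimes>\<^sub>M N. norm ((size p)\<^sup>2) \<le> norm (3 * (1 + (norm (X (fst p)))\<^sup>2 + (norm (Y (snd p)))\<^sup>2))"
    proof (rule AE_I2)
      fix p
      have "(1 + x + y)\<^sup>2 \<le> 3 * (1 + x\<^sup>2 + y\<^sup>2)" for x y :: real
        using zero_le_power2[of "x - y"] zero_le_power2[of "x - 1"] zero_le_power2[of "y - 1"]
        by (simp add: power2_eq_square algebra_simps)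
      then show "norm ((size p)\<^sup>2) \<le> norm (3 * (1 + (norm (X (fst p)))\<^sup>2 + (norm (Y (snd p)))\<^sup>2))"
        by (simp add: size_def)
    qed
  qed (simp add: size_def)
qed

lemma integrable_size_bound:
  fixes h :: "'a \<times> 'b \<Rightarrow> real"
  assumes "h \<in> borel_measurable (M \<Otimes>\<^sub>M N)" and "\<And>p. \<bar>h p\<bar> \<le> C * (size p)\<^sup>2"
  shows "integrable (M \<Otimes>\<^sub>M N) h"
proof (rule Bochner_Integration.integrable_bound[OF integrable_mult_right[OF integrable_size_power2, of C] assms(1)], rule AE_I2)
  show "norm (h p) \<le> norm (C * (size p)\<^sup>2)" for p
    using assms(2)[of p] by simp
qed

lemma tame_mix_bound:
  assumes G: "has_tame_gradient G G'"
  obtains C where "0 \<le> C" "\<And>a b p. \<bar>a\<bar> \<le> 1 \<Longrightarrow> \<bar>b\<bar> \<le> 1 \<Longrightarrow> \<bar>G (mix a b p)\<bar> \<le> C * size p"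
    "\<And>j a b p. \<bar>a\<bar> \<le> 1 \<Longrightarrow> \<bar>b\<bar> \<le> 1 \<Longrightarrow> \<bar>G' j (mix a b p)\<bar> \<le> C * size p"
proof -
  obtain C where C: "0 \<le> C" "\<And>x. \<bar>G x\<bar> \<le> C * (1 + norm x)" "\<And>j x. \<bar>G' j x\<bar> \<le> C * (1 + norm x)"
    using has_tame_gradient_bound[OF G] by blast
  then show ?thesis
    by (intro that[of C]) (auto intro: order_trans[OF _ mult_left_mono[OF norm_mix_le]])
qed

lemma integrable_tame:
  assumes G: "has_tame_gradient G G'" and ab: "\<bar>a\<bar> \<le> 1" "\<bar>b\<bar> \<le> 1"
  shows "integrable (M \<Otimes>\<^sub>M N) (\<lambda>p. X (fst p) $ i * G (mix a b p))"
    and "integrable (M \<Otimes>\<^sub>M N) (\<lambda>p. Y (snd p) $ i * G (mix a b p))"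
    and "integrable (M \<Otimes>\<^sub>M N) (\<lambda>p. G (mix a b p))"
    and "integrable (M \<Otimes>\<^sub>M N) (\<lambda>p. G' j (mix a b p))"
proof -
  obtain C where C: "0 \<le> C" "\<And>p. \<bar>G (mix a b p)\<bar> \<le> C * size p" "\<And>j p. \<bar>G' j (mix a b p)\<bar> \<le> C * size p"
    using tame_mix_bound[OF G] ab by metis
  note [measurable] = has_tame_gradient_measurable[OF G] has_tame_gradient_measurable'[OF G]
  have le: "C * size p \<le> C * (size p)\<^sup>2" for p
    using C(1) size_ge_1[of p] by (intro mult_left_mono self_le_power) auto
  show "integrable (M \<Otimes>\<^sub>M N) (\<lambda>p. G (mix a b p))"
    by (rule integrable_size_bound[OF _ order_trans[OF C(2) le]]) measurable
  show "integrable (M \<Otimes>\<^sub>M N) (\<lambda>p. G' j (mix a b p))"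
    by (rule integrable_size_bound[OF _ order_trans[OF C(3) le]]) measurable
  have XY: "\<bar>X (fst p) $ i\<bar> \<le> size p" "\<bar>Y (snd p) $ i\<bar> \<le> size p" for p
    using component_le_norm_cart[of "X (fst p)" i] component_le_norm_cart[of "Y (snd p)" i]
      norm_ge_zero[of "X (fst p)"] norm_ge_zero[of "Y (snd p)"] unfolding size_def by linarith+
  have mul: "\<bar>x * G (mix a b p)\<bar> \<le> C * (size p)\<^sup>2" if "\<bar>x\<bar> \<le> size p" for x p
    using mult_mono[OF that C(2)[of p]] size_ge_1[of p] by (simp add: abs_mult power2_eq_square mult_ac)
  show "integrable (M \<Otimes>\<^sub>M N) (\<lambda>p. X (fst p) $ i * G (mix a b p))"
    by (rule integrable_size_bound[OF _ mul[OF XY(1)]]) measurable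
  show "integrable (M \<Otimes>\<^sub>M N) (\<lambda>p. Y (snd p) $ i * G (mix a b p))"
    by (rule integrable_size_bound[OF _ mul[OF XY(2)]]) measurable
qed

text \<open>With the second coordinate of the product frozen, \<open>G\<close> composed with
  \<open>mix\<close> is an affine substitution in \<open>X\<close>. The one-vector formula applies,
  the chain rule gives the factor \<open>a\<close>, and Fubini reassembles the expectations.\<close>

lemma integration_by_parts_fst:
  assumes G: "has_tame_gradient G G'" and ab: "\<bar>a\<bar> \<le> 1" "\<bar>b\<bar> \<le> 1"
  shows "expectation (\<lambda>p. X (fst p) $ i * G (mix a b p)) =
    a * (\<Sum>j\<in>UNIV. X.expectation (\<lambda>\<omega>. X \<omega> $ i * X \<omega> $ j) * expectation (\<lambda>p. G' j (mix a b p)))"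
proof -
  have swap: "expectation h = (LINT y|N. (LINT x|M. h (x, y)))" if "integrable (M \<Otimes>\<^sub>M N) h" for h :: "'a \<times> 'b \<Rightarrow> real"
    using integral_snd[of "curry h"] that by simp
  define cov where "cov j = X.expectation (\<lambda>\<omega>. X \<omega> $ i * X \<omega> $ j)" for j
  note int = integrable_tame[OF G ab]
  have "expectation (\<lambda>p. X (fst p) $ i * G (mix a b p)) = (LINT y|N. (LINT x|M. X x $ i * G (a *\<^sub>R X x + b *\<^sub>R Y y)))"
    by (subst swap[OF int(1)]) (simp add: mix_def)
  also have "\<dots> = (LINT y|N. (\<Sum>j\<in>UNIV. cov j * (LINT x|M. a * G' j (a *\<^sub>R X x + b *\<^sub>R Y y))))"
    by (subst X.gaussian_integration_by_parts[OF has_tame_gradient_affine[OF G]]) (simp add: cov_def)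
  also have "\<dots> = (LINT y|N. (\<Sum>j\<in>UNIV. (a * cov j) * (LINT x|M. G' j (mix a b (x, y)))))"
    by (simp add: mix_def mult_ac)
  also have "\<dots> = (\<Sum>j\<in>UNIV. (a * cov j) * (LINT y|N. (LINT x|M. G' j (mix a b (x, y)))))"
    using integrable_snd[of "curry (\<lambda>p. G' _ (mix a b p))"] int(4) by simp
  also have "\<dots> = (\<Sum>j\<in>UNIV. (a * cov j) * expectation (\<lambda>p. G' j (mix a b p)))"
    by (simp add: swap[OF int(4)])
  finally show ?thesis by (simp add: cov_def sum_distrib_left mult_ac)
qed

end

lemma gaussian_pair_swap: "gaussian_pair M X N Y \<Longrightarrow> gaussian_pair N Y M X"
  by (simp add: gaussian_pair_def)

section \<open>Differentiation of expectations along the arc\<close>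

context gaussian_pair
begin

lemma integration_by_parts_snd:
  assumes G: "has_tame_gradient G G'" and ab: "\<bar>a\<bar> \<le> 1" "\<bar>b\<bar> \<le> 1"
  shows "expectation (\<lambda>p. Y (snd p) $ i * G (mix a b p)) =
    b * (\<Sum>j\<in>UNIV. Y.expectation (\<lambda>\<omega>. Y \<omega> $ i * Y \<omega> $ j) * expectation (\<lambda>p. G' j (mix a b p)))"
proof -
  interpret S: gaussian_pair N Y M X by (rule gaussian_pair_swap) unfold_locales
  note [measurable] = has_tame_gradient_measurable[OF G] has_tame_gradient_measurable'[OF G]
  have mix: "S.mix b a (y, x) = mix a b (x, y)" for x y by (simp add: S.mix_def mix_def add.commute)
  have sw: "expectation h = S.expectation (\<lambda>(y, x). h (x, y))" if "h \<in> borel_measurable (M \<Otimes>\<^sub>M N)" for h :: "'a \<times> 'b \<Rightarrow> real"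
    using integral_product_swap[OF that] by simp
  have "expectation (\<lambda>p. Y (snd p) $ i * G (mix a b p)) = S.expectation (\<lambda>p. Y (fst p) $ i * G (S.mix b a p))"
    by (subst sw) (auto simp: mix[symmetric] case_prod_beta')
  also have "\<dots> = b * (\<Sum>j\<in>UNIV. Y.expectation (\<lambda>\<omega>. Y \<omega> $ i * Y \<omega> $ j) * S.expectation (\<lambda>p. G' j (S.mix b a p)))"
    by (rule S.integration_by_parts_fst[OF G ab(2,1)])
  also have "(\<lambda>j. S.expectation (\<lambda>p. G' j (S.mix b a p))) = (\<lambda>j. expectation (\<lambda>p. G' j (mix a b p)))"
    by (subst sw) (auto simp: mix[symmetric] case_prod_beta')
  finally show ?thesis .
qed

text \<open>Used with \<open>c\<close>, \<open>d\<close> equal to \<open>a\<close>, \<open>b\<close>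
  for orthogonality, and with \<open>- sin t\<close>, \<open>cos t\<close> against
  \<open>cos t\<close>, \<open>sin t\<close> for the derivative, where the bracket becomes
  \<open>sin t * cos t * cov_diff i j\<close>.\<close>

lemma expectation_mix_mult:
  assumes G: "has_tame_gradient G G'" and ab: "\<bar>a\<bar> \<le> 1" "\<bar>b\<bar> \<le> 1"
  shows "expectation (\<lambda>p. mix c d p $ i * G (mix a b p)) =
    (\<Sum>j\<in>UNIV. (c * a * X.expectation (\<lambda>\<omega>. X \<omega> $ i * X \<omega> $ j) + d * b * Y.expectation (\<lambda>\<omega>. Y \<omega> $ i * Y \<omega> $ j))
      * expectation (\<lambda>p. G' j (mix a b p)))"
proof -
  have "mix c d p $ i * G (mix a b p) = c * (X (fst p) $ i * G (mix a b p)) + d * (Y (snd p) $ i * G (mix a b p))" for p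
    by (simp add: mix_def[of c d] algebra_simps)
  then have "expectation (\<lambda>p. mix c d p $ i * G (mix a b p)) =
      c * expectation (\<lambda>p. X (fst p) $ i * G (mix a b p)) + d * expectation (\<lambda>p. Y (snd p) $ i * G (mix a b p))"
    using integrable_tame[OF G ab] by simp
  then show ?thesis
    by (simp add: integration_by_parts_fst[OF G ab] integration_by_parts_snd[OF G ab] sum_distrib_left
        sum.distrib[symmetric] algebra_simps)
qed

definition cov_diff :: "'n \<Rightarrow> 'n \<Rightarrow> real" where
  "cov_diff i j = Y.expectation (\<lambda>\<omega>. Y \<omega> $ i * Y \<omega> $ j) - X.expectation (\<lambda>\<omega>. X \<omega> $ i * X \<omega> $ j)"

abbreviation arc :: "real \<Rightarrow> 'a \<times> 'b \<Rightarrow> real ^ 'n" where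
  "arc t \<equiv> mix (cos t) (sin t)"

text \<open>Differentiating under the expectation gives the gradient paired with the velocity of the
  arc, and integration by parts turns the velocity into second derivatives. Tameness is asked of the
  gradient only, since \<open>\<Phi>\<close> will be a square of quadratic growth.\<close>

theorem arc_derivative:
  assumes der: "\<And>x. (\<Phi> has_derivative (\<lambda>h. \<Sum>j\<in>UNIV. g j x * h $ j)) (at x)"
    and g: "\<And>j. has_tame_gradient (g j) (H j)"
    and int: "\<And>t. integrable (M \<Otimes>\<^sub>M N) (\<lambda>p. \<Phi> (arc t p))"
  shows "((\<lambda>t. expectation (\<lambda>p. \<Phi> (arc t p))) has_real_derivative
     sin t * cos t * (\<Sum>j\<in>UNIV. \<Sum>k\<in>UNIV. cov_diff j k * expectation (\<lambda>p. H j k (arc t p)))) (at t)"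
proof -
  note [measurable] = has_tame_gradient_measurable[OF g]
  let ?Z' = "\<lambda>t. mix (- sin t) (cos t)"
  have "\<forall>j. \<exists>C. \<forall>t p. \<bar>g j (arc t p)\<bar> \<le> C * size p"
  proof
    fix j
    show "\<exists>C. \<forall>t p. \<bar>g j (arc t p)\<bar> \<le> C * size p"
      using tame_mix_bound[OF g[of j]] abs_cos_le_one abs_sin_le_one by metis
  qed
  then obtain C where C: "\<And>j t p. \<bar>g j (arc t p)\<bar> \<le> C j * size p" by metis
  have d: "((\<lambda>t. expectation (\<lambda>p. \<Phi> (arc t p))) has_real_derivative
     expectation (\<lambda>p. \<Sum>j\<in>UNIV. g j (arc t p) * ?Z' t p $ j)) (at t)"
  proof (rule has_real_derivative_integral[OF _ int, where w = "\<lambda>p. (\<Sum>j\<in>UNIV. C j) * (size p)\<^sup>2"])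
    fix t p
    have 1: "((\<lambda>t. arc t p) has_derivative (\<lambda>h. h *\<^sub>R ?Z' t p)) (at t)"
      unfolding mix_def by (auto intro!: derivative_eq_intros simp: algebra_simps)
    have "((\<lambda>t. \<Phi> (arc t p)) has_derivative (\<lambda>h. \<Sum>j\<in>UNIV. g j (arc t p) * (h *\<^sub>R ?Z' t p) $ j)) (at t)"
      by (rule has_derivative_compose[OF 1 der])
    also have "(\<lambda>h. \<Sum>j\<in>UNIV. g j (arc t p) * (h *\<^sub>R ?Z' t p) $ j) = (*) (\<Sum>j\<in>UNIV. g j (arc t p) * ?Z' t p $ j)"
      by (simp add: fun_eq_iff sum_distrib_left sum_distrib_right mult_ac)
    finally show "((\<lambda>t. \<Phi> (arc t p)) has_real_derivative (\<Sum>j\<in>UNIV. g j (arc t p) * ?Z' t p $ j)) (at t)"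
      by (simp add: has_field_derivative_def)
    have "\<bar>\<Sum>j\<in>UNIV. g j (arc t p) * ?Z' t p $ j\<bar> \<le> (\<Sum>j\<in>UNIV. C j * size p * size p)"
    proof (rule order_trans[OF sum_abs], rule sum_mono)
      fix j
      have "\<bar>?Z' t p $ j\<bar> \<le> size p"
        using component_le_norm_cart[of "?Z' t p" j] norm_mix_le[of "- sin t" "cos t" p] by simp
      then show "\<bar>g j (arc t p) * ?Z' t p $ j\<bar> \<le> C j * size p * size p"
        unfolding abs_mult using C[of j t p] size_ge_1[of p] by (intro mult_mono) auto
    qed
    then show "\<bar>\<Sum>j\<in>UNIV. g j (arc t p) * ?Z' t p $ j\<bar> \<le> (\<Sum>j\<in>UNIV. C j) * (size p)\<^sup>2"
      by (simp add: power2_eq_square sum_distrib_right mult_ac)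
  next
    show "integrable (M \<Otimes>\<^sub>M N) (\<lambda>p. (\<Sum>j\<in>UNIV. C j) * (size p)\<^sup>2)"
      by (intro integrable_mult_right integrable_size_power2)
  qed measurable
  have i: "integrable (M \<Otimes>\<^sub>M N) (\<lambda>p. ?Z' t p $ j * g j (arc t p))" for j
  proof -
    have "?Z' t p $ j * g j (arc t p) = - sin t * (X (fst p) $ j * g j (arc t p)) + cos t * (Y (snd p) $ j * g j (arc t p))" for p
      by (simp add: mix_def[of "- sin t"] algebra_simps)
    then show ?thesis using integrable_tame(1,2)[OF g, of "cos t" "sin t"] by simp
  qed
  have "expectation (\<lambda>p. \<Sum>j\<in>UNIV. g j (arc t p) * ?Z' t p $ j) = (\<Sum>j\<in>UNIV. expectation (\<lambda>p. ?Z' t p $ j * g j (arc t p)))"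
    using i by (simp add: mult.commute)
  also have "\<dots> = (\<Sum>j\<in>UNIV. \<Sum>k\<in>UNIV. (sin t * cos t * cov_diff j k) * expectation (\<lambda>p. H j k (arc t p)))"
    by (subst expectation_mix_mult[OF g]) (auto simp: cov_diff_def algebra_simps intro!: sum.cong)
  also have "\<dots> = sin t * cos t * (\<Sum>j\<in>UNIV. \<Sum>k\<in>UNIV. cov_diff j k * expectation (\<lambda>p. H j k (arc t p)))"
    by (simp add: sum_distrib_left mult.assoc)
  finally show ?thesis using d by simp
qed

lemma expectation_fst:
  assumes [measurable]: "h \<in> borel_measurable M"
  shows "expectation (\<lambda>p. h (fst p)) = (LINT \<omega>|M. h \<omega> :: real)"
proof -
  have "(LINT \<omega>|M. h \<omega>) = (LINT \<omega>|distr (M \<Otimes>\<^sub>M N) M fst. h \<omega>)" by (simp add: Y.distr_pair_fst)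
  also have "\<dots> = expectation (\<lambda>p. h (fst p))" by (subst integral_distr) auto
  finally show ?thesis by simp
qed

lemma expectation_snd:
  assumes [measurable]: "h \<in> borel_measurable N"
  shows "expectation (\<lambda>p. h (snd p)) = (LINT \<omega>|N. h \<omega> :: real)"
proof -
  interpret S: gaussian_pair N Y M X by (rule gaussian_pair_swap) unfold_locales
  show ?thesis
    using integral_product_swap[of "\<lambda>p. h (snd p)"] S.expectation_fst[OF assms]
    by (simp add: case_prod_beta')
qed

end

section \<open>The softmax function and its gradient\<close>

lemma has_tame_gradientI:
  assumes "\<And>x. (G has_derivative (\<lambda>h. \<Sum>j\<in>UNIV. G' j x * h $ j)) (at x)"
    and "\<And>j. continuous_on UNIV (G' j)"
    and "\<And>x. \<bar>G x\<bar> \<le> C * (1 + norm x)" and "\<And>j x. \<bar>G' j x\<bar> \<le> C * (1 + norm x)"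
  shows "has_tame_gradient G G'"
  using assms unfolding has_tame_gradient_def by blast

lemma has_tame_gradient_const: "has_tame_gradient (\<lambda>_. c) (\<lambda>_ _. 0)"
  by (rule has_tame_gradientI[where C = "\<bar>c\<bar>"]) (auto intro!: mult_le_cancel_left1[THEN iffD2])

lemma has_tame_gradient_inner: "has_tame_gradient (\<lambda>x. c \<bullet> x) (\<lambda>j _. c $ j)"
proof (rule has_tame_gradientI[where C = "norm c"])
  show "((\<lambda>x. c \<bullet> x) has_derivative (\<lambda>h. \<Sum>j\<in>UNIV. c $ j * h $ j)) (at x)" for x
    using bounded_linear_imp_has_derivative[OF bounded_linear_inner_right[of c], of "at x"]
    by (simp add: inner_vec_def[of c, abs_def])
  show "\<bar>c \<bullet> x\<bar> \<le> norm c * (1 + norm x)" for x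
    using Cauchy_Schwarz_ineq2[of c x] by (simp add: distrib_left add_increasing)
  show "\<bar>c $ j\<bar> \<le> norm c * (1 + norm x)" for j and x :: "real ^ 'a"
    using component_le_norm_cart[of c j] by (simp add: distrib_left add_increasing2)
qed auto

lemma has_tame_gradient_add:
  assumes G: "has_tame_gradient G G'" and K: "has_tame_gradient K K'"
  shows "has_tame_gradient (\<lambda>x. G x + K x) (\<lambda>j x. G' j x + K' j x)"
proof -
  obtain C where C: "0 \<le> C" "\<And>x. \<bar>G x\<bar> \<le> C * (1 + norm x)" "\<And>j x. \<bar>G' j x\<bar> \<le> C * (1 + norm x)"
    using has_tame_gradient_bound[OF G] by blast
  obtain D where D: "0 \<le> D" "\<And>x. \<bar>K x\<bar> \<le> D * (1 + norm x)" "\<And>j x. \<bar>K' j x\<bar> \<le> D * (1 + norm x)"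
    using has_tame_gradient_bound[OF K] by blast
  show ?thesis
  proof (rule has_tame_gradientI[where C = "C + D"])
    show "((\<lambda>x. G x + K x) has_derivative (\<lambda>h. \<Sum>j\<in>UNIV. (G' j x + K' j x) * h $ j)) (at x)" for x
      using has_derivative_add[OF has_tame_gradient_derivative[OF G] has_tame_gradient_derivative[OF K], of x]
      by (simp add: sum.distrib distrib_right)
    show "continuous_on UNIV (\<lambda>x. G' j x + K' j x)" for j
      by (intro continuous_intros has_tame_gradient_continuous'[OF G] has_tame_gradient_continuous'[OF K])
    show "\<bar>G x + K x\<bar> \<le> (C + D) * (1 + norm x)" for x
      unfolding distrib_right by (rule order_trans[OF abs_triangle_ineq add_mono[OF C(2) D(2)]])
    show "\<bar>G' j x + K' j x\<bar> \<le> (C + D) * (1 + norm x)" for j x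
      unfolding distrib_right by (rule order_trans[OF abs_triangle_ineq add_mono[OF C(3) D(3)]])
  qed
qed

text \<open>Two factors of linear growth would multiply to quadratic growth, so one factor is taken
  bounded together with its gradient; it will be a Gibbs weight minus a constant.\<close>

lemma has_tame_gradient_mult_bounded:
  assumes G: "has_tame_gradient G G'" and K: "has_tame_gradient K K'"
    and bK: "\<And>x. \<bar>K x\<bar> \<le> B" and bK': "\<And>j x. \<bar>K' j x\<bar> \<le> B"
  shows "has_tame_gradient (\<lambda>x. G x * K x) (\<lambda>j x. G' j x * K x + G x * K' j x)"
proof -
  obtain C where C: "0 \<le> C" "\<And>x. \<bar>G x\<bar> \<le> C * (1 + norm x)" "\<And>j x. \<bar>G' j x\<bar> \<le> C * (1 + norm x)"
    using has_tame_gradient_bound[OF G] by blast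
  have B: "0 \<le> B" using bK[of 0] by simp
  have m: "\<bar>a * b\<bar> \<le> C * B * (1 + norm x)" if "\<bar>a\<bar> \<le> C * (1 + norm x)" "\<bar>b\<bar> \<le> B" for a b and x :: "real^'a"
    using mult_mono[OF that] C(1) by (simp add: abs_mult mult_ac)
  have CB: "0 \<le> C * B * (1 + norm x)" for x :: "real^'a" using C(1) B by simp
  show ?thesis
  proof (rule has_tame_gradientI[where C = "2 * (C * B)"])
    show "((\<lambda>x. G x * K x) has_derivative (\<lambda>h. \<Sum>j\<in>UNIV. (G' j x * K x + G x * K' j x) * h $ j)) (at x)" for x
    proof -
      have "(\<lambda>h. G x * (\<Sum>j\<in>UNIV. K' j x * h $ j) + (\<Sum>j\<in>UNIV. G' j x * h $ j) * K x) =
          (\<lambda>h. \<Sum>j\<in>UNIV. (G' j x * K x + G x * K' j x) * h $ j)"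
        unfolding sum_distrib_left sum_distrib_right sum.distrib[symmetric]
        by (intro ext sum.cong) (auto simp: algebra_simps)
      then show ?thesis
        using has_derivative_mult[OF has_tame_gradient_derivative[OF G] has_tame_gradient_derivative[OF K], of x]
        by simp
    qed
    show "continuous_on UNIV (\<lambda>x. G' j x * K x + G x * K' j x)" for j
      by (intro continuous_intros has_tame_gradient_continuous'[OF G] has_tame_gradient_continuous'[OF K]
          has_tame_gradient_continuous[OF G] has_tame_gradient_continuous[OF K])
    show "\<bar>G x * K x\<bar> \<le> 2 * (C * B) * (1 + norm x)" for x
      using m[OF C(2)[of x] bK[of x]] CB[of x] by simp
    show "\<bar>G' j x * K x + G x * K' j x\<bar> \<le> 2 * (C * B) * (1 + norm x)" for j x
      using add_mono[OF m[OF C(3)[of j x] bK[of x]] m[OF C(2)[of x] bK'[of j x]]] abs_triangle_ineq[of "G' j x * K x" "G x * K' j x"]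
      by (simp only: mult_2 distrib_right)
  qed
qed

text \<open>The Gibbs weights at inverse temperature \<open>\<beta>\<close>, which form the gradient
  of \<open>softmax \<beta>\<close>.\<close>

definition gibbs :: "real \<Rightarrow> real ^ 'n \<Rightarrow> 'n \<Rightarrow> real" where
  "gibbs \<beta> x i = exp (\<beta> * x $ i) / (\<Sum>k\<in>UNIV. exp (\<beta> * x $ k))"

lemma sum_exp_pos: "0 < (\<Sum>k\<in>UNIV. exp (\<beta> * x $ k) :: real)" for x :: "real ^ 'n"
  by (rule sum_pos) auto

lemma gibbs_nonneg: "0 \<le> gibbs \<beta> x i"
  using sum_exp_pos[of \<beta> x] by (simp add: gibbs_def)

lemma sum_gibbs: "(\<Sum>i\<in>UNIV. gibbs \<beta> x i) = 1"
  using sum_exp_pos[of \<beta> x] by (simp add: gibbs_def sum_divide_distrib[symmetric])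

lemma gibbs_le_1: "gibbs \<beta> x i \<le> 1"
  using sum_gibbs[of \<beta> x] member_le_sum[of i UNIV "gibbs \<beta> x"] by (simp add: gibbs_nonneg)

lemma softmax_ge:
  fixes x :: "real ^ 'n"
  assumes "0 < \<beta>"
  shows "x $ i \<le> softmax \<beta> x"
proof -
  have "exp (\<beta> * x $ i) \<le> (\<Sum>k\<in>UNIV. exp (\<beta> * x $ k))"
    by (rule member_le_sum) auto
  then have "\<beta> * x $ i \<le> ln (\<Sum>k\<in>UNIV. exp (\<beta> * x $ k))"
    using sum_exp_pos[of \<beta> x] by (simp add: ln_ge_iff)
  then show ?thesis using assms by (simp add: softmax_def field_simps)
qed

lemma softmax_le:
  fixes x :: "real ^ 'n"
  assumes "0 < \<beta>" and le: "\<And>i. x $ i \<le> m"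
  shows "softmax \<beta> x \<le> m + ln (real CARD('n)) / \<beta>"
proof -
  have "(\<Sum>k\<in>UNIV. exp (\<beta> * x $ k)) \<le> (\<Sum>k\<in>(UNIV :: 'n set). exp (\<beta> * m))"
    using assms by (intro sum_mono) simp
  then have "ln (\<Sum>k\<in>UNIV. exp (\<beta> * x $ k)) \<le> ln (real CARD('n) * exp (\<beta> * m))"
    using sum_exp_pos[of \<beta> x] by simp
  also have "\<dots> = ln (real CARD('n)) + \<beta> * m" by (simp add: ln_mult)
  finally show ?thesis using assms by (simp add: softmax_def field_simps)
qed

lemma softmax_tame:
  assumes \<beta>: "0 < \<beta>"
  shows "has_tame_gradient (softmax \<beta> :: real ^ 'n \<Rightarrow> real) (\<lambda>j x. gibbs \<beta> x j)"
proof (rule has_tame_gradientI[where C = "1 + ln (real CARD('n)) / \<beta>"])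
  have dexp: "((\<lambda>x. exp (\<beta> * x $ k)) has_derivative (\<lambda>h. exp (\<beta> * x $ k) * (\<beta> * h $ k))) (at x)" for k and x :: "real ^ 'n"
    by (auto intro!: derivative_eq_intros bounded_linear_vec_nth[THEN bounded_linear_imp_has_derivative])
  have "((\<lambda>x. (1 / \<beta>) * ln (\<Sum>k\<in>UNIV. exp (\<beta> * x $ k))) has_derivative
     (\<lambda>h. (1 / \<beta>) * ((\<Sum>k\<in>UNIV. exp (\<beta> * x $ k) * (\<beta> * h $ k)) * inverse (\<Sum>k\<in>UNIV. exp (\<beta> * x $ k))))) (at x)" for x :: "real ^ 'n"
    by (intro has_derivative_mult_right has_derivative_ln has_derivative_sum dexp sum_exp_pos)
  also have "(\<lambda>h. (1 / \<beta>) * ((\<Sum>k\<in>UNIV. exp (\<beta> * x $ k) * (\<beta> * h $ k)) * inverse (\<Sum>k\<in>UNIV. exp (\<beta> * x $ k))))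
     = (\<lambda>h. \<Sum>j\<in>UNIV. gibbs \<beta> x j * h $ j)" for x :: "real ^ 'n"
    unfolding gibbs_def sum_distrib_left sum_distrib_right
    by (intro ext sum.cong refl) (use \<beta> sum_exp_pos[of \<beta> x] in \<open>simp add: field_simps\<close>)
  finally show "(softmax \<beta> has_derivative (\<lambda>h. \<Sum>j\<in>UNIV. gibbs \<beta> x j * h $ j)) (at x)" for x :: "real ^ 'n"
    unfolding softmax_def[abs_def] .
  show "continuous_on UNIV (\<lambda>x. gibbs \<beta> x j)" for j :: 'n
    unfolding gibbs_def by (intro continuous_intros) (simp add: sum_exp_pos[THEN less_imp_neq, THEN not_sym])
  have ln: "0 \<le> ln (real CARD('n)) / \<beta>" using \<beta> by (simp add: Suc_leI)
  show "\<bar>softmax \<beta> x\<bar> \<le> (1 + ln (real CARD('n)) / \<beta>) * (1 + norm x)" for x :: "real ^ 'n"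
  proof -
    have c: "x $ i \<le> norm x" "- norm x \<le> x $ i" for i
      using component_le_norm_cart[of x i] by linarith+
    have "softmax \<beta> x \<le> norm x + ln (real CARD('n)) / \<beta>" "- norm x \<le> softmax \<beta> x"
      using softmax_le[OF \<beta> c(1)] order_trans[OF c(2) softmax_ge[OF \<beta>]] by auto
    moreover have "0 \<le> ln (real CARD('n)) / \<beta> * norm x" by (rule mult_nonneg_nonneg[OF ln norm_ge_zero])
    moreover have "(1 + ln (real CARD('n)) / \<beta>) * (1 + norm x) = 1 + norm x + ln (real CARD('n)) / \<beta> + ln (real CARD('n)) / \<beta> * norm x"
      by (simp only: ring_distribs mult_1 mult_1_right add_ac)
    ultimately show ?thesis using ln norm_ge_zero[of x] by linarith
  qed
  show "\<bar>gibbs \<beta> x j\<bar> \<le> (1 + ln (real CARD('n)) / \<beta>) * (1 + norm x)" for j and x :: "real ^ 'n"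
    using mult_mono[of 1 "1 + ln (real CARD('n)) / \<beta>" 1 "1 + norm x"] ln gibbs_le_1[of \<beta> x j] gibbs_nonneg[of \<beta> x j] by simp
qed

lemma gibbs_gradient_bound: "\<bar>gibbs \<beta> x i * ((if i = j then 1 else 0) - gibbs \<beta> x j)\<bar> \<le> 1"
proof -
  have "\<bar>(if i = j then 1 else 0) - gibbs \<beta> x j\<bar> \<le> 1"
    using gibbs_nonneg[of \<beta> x j] gibbs_le_1[of \<beta> x j] by auto
  then show ?thesis
    using gibbs_nonneg[of \<beta> x i] gibbs_le_1[of \<beta> x i] by (auto simp: abs_mult intro!: mult_le_one)
qed

text \<open>The derivative is the Hessian of \<open>softmax \<beta>\<close>: \<open>\<beta>\<close>
  times the diagonal matrix of the weights minus their outer product.\<close>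

lemma gibbs_tame:
  fixes i :: "'n::finite"
  assumes \<beta>: "0 < \<beta>"
  shows "has_tame_gradient (\<lambda>x. gibbs \<beta> x i) (\<lambda>j x. \<beta> * (gibbs \<beta> x i * ((if i = j then 1 else 0) - gibbs \<beta> x j)))"
proof (rule has_tame_gradientI[where C = "1 + \<beta>"])
  fix x :: "real ^ 'n"
  define S where "S = (\<Sum>k\<in>UNIV. exp (\<beta> * x $ k))"
  have S: "S > 0" unfolding S_def by (rule sum_exp_pos)
  have dexp: "((\<lambda>x. exp (\<beta> * x $ k)) has_derivative (\<lambda>h. exp (\<beta> * x $ k) * (\<beta> * h $ k))) (at x)" for k
    by (auto intro!: derivative_eq_intros bounded_linear_vec_nth[THEN bounded_linear_imp_has_derivative])
  have dS: "((\<lambda>x. \<Sum>k\<in>UNIV. exp (\<beta> * x $ k)) has_derivative (\<lambda>h. \<Sum>k\<in>UNIV. exp (\<beta> * x $ k) * (\<beta> * h $ k))) (at x)"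
    by (intro has_derivative_sum dexp)
  have "((\<lambda>x. gibbs \<beta> x i) has_derivative
     (\<lambda>h. ((exp (\<beta> * x $ i) * (\<beta> * h $ i)) * S - exp (\<beta> * x $ i) * (\<Sum>k\<in>UNIV. exp (\<beta> * x $ k) * (\<beta> * h $ k))) / (S * S))) (at x)"
    unfolding gibbs_def using has_derivative_divide'[OF dexp dS] S by (simp add: S_def)
  also have "(\<lambda>h. ((exp (\<beta> * x $ i) * (\<beta> * h $ i)) * S - exp (\<beta> * x $ i) * (\<Sum>k\<in>UNIV. exp (\<beta> * x $ k) * (\<beta> * h $ k))) / (S * S))
    = (\<lambda>h. \<Sum>j\<in>UNIV. \<beta> * (gibbs \<beta> x i * ((if i = j then 1 else 0) - gibbs \<beta> x j)) * h $ j)"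
  proof
    fix h
    have g: "exp (\<beta> * x $ k) = gibbs \<beta> x k * S" for k using S by (simp add: gibbs_def S_def)
    have "(\<Sum>j\<in>UNIV. \<beta> * (gibbs \<beta> x i * ((if i = j then 1 else 0) - gibbs \<beta> x j)) * h $ j)
      = (\<Sum>j\<in>UNIV. if i = j then \<beta> * gibbs \<beta> x i * h $ j else 0) - \<beta> * gibbs \<beta> x i * (\<Sum>j\<in>UNIV. gibbs \<beta> x j * h $ j)"
      unfolding sum_distrib_left sum_subtractf[symmetric] by (rule sum.cong) (auto simp: algebra_simps)
    then have r: "(\<Sum>j\<in>UNIV. \<beta> * (gibbs \<beta> x i * ((if i = j then 1 else 0) - gibbs \<beta> x j)) * h $ j)
      = \<beta> * gibbs \<beta> x i * h $ i - \<beta> * gibbs \<beta> x i * (\<Sum>j\<in>UNIV. gibbs \<beta> x j * h $ j)"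
      by simp
    have l: "(\<Sum>k\<in>UNIV. exp (\<beta> * x $ k) * (\<beta> * h $ k)) = S * \<beta> * (\<Sum>j\<in>UNIV. gibbs \<beta> x j * h $ j)"
      unfolding g sum_distrib_left by (rule sum.cong) (auto simp: algebra_simps)
    show "((exp (\<beta> * x $ i) * (\<beta> * h $ i)) * S - exp (\<beta> * x $ i) * (\<Sum>k\<in>UNIV. exp (\<beta> * x $ k) * (\<beta> * h $ k))) / (S * S)
      = (\<Sum>j\<in>UNIV. \<beta> * (gibbs \<beta> x i * ((if i = j then 1 else 0) - gibbs \<beta> x j)) * h $ j)"
      unfolding r l g[of i] using S by (simp add: field_simps)
  qed
  finally show "((\<lambda>x. gibbs \<beta> x i) has_derivative (\<lambda>h. \<Sum>j\<in>UNIV. \<beta> * (gibbs \<beta> x i * ((if i = j then 1 else 0) - gibbs \<beta> x j)) * h $ j)) (at x)" .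
next
  show "continuous_on UNIV (\<lambda>x. \<beta> * (gibbs \<beta> x i * ((if i = j then 1 else 0) - gibbs \<beta> x j)))" for j
    using has_tame_gradient_continuous'[OF softmax_tame[OF \<beta>]] by (intro continuous_intros) auto
  show "\<bar>gibbs \<beta> x i\<bar> \<le> (1 + \<beta>) * (1 + norm x)" for x
    using mult_mono[of 1 "1 + \<beta>" 1 "1 + norm x"] \<beta> gibbs_le_1[of \<beta> x i] gibbs_nonneg[of \<beta> x i] by simp
  show "\<bar>\<beta> * (gibbs \<beta> x i * ((if i = j then 1 else 0) - gibbs \<beta> x j))\<bar> \<le> (1 + \<beta>) * (1 + norm x)" for j x
  proof -
    have "\<beta> * \<bar>gibbs \<beta> x i * ((if i = j then 1 else 0) - gibbs \<beta> x j)\<bar> \<le> \<beta> * 1"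
      by (intro mult_left_mono gibbs_gradient_bound) (use \<beta> in auto)
    moreover have "1 + \<beta> \<le> (1 + \<beta>) * (1 + norm x)" using \<beta> by (simp add: distrib_left)
    ultimately show ?thesis unfolding abs_mult[of \<beta>] abs_of_pos[OF \<beta>] by linarith
  qed
qed

text \<open>The linear part is taken in \<open>x\<close> and not in \<open>x + \<mu>\<close>, as the
  projection concerns the span of the centered coordinates.\<close>

definition softmax_residual :: "real \<Rightarrow> real ^ 'n \<Rightarrow> real ^ 'n \<Rightarrow> real ^ 'n \<Rightarrow> real" where
  "softmax_residual \<beta> \<mu> c x = softmax \<beta> (x + \<mu>) + 1 / \<beta> - c \<bullet> x"

lemma softmax_residual_tame:
  assumes \<beta>: "0 < \<beta>"
  shows "has_tame_gradient (softmax_residual \<beta> \<mu> c) (\<lambda>j x. gibbs \<beta> (x + \<mu>) j - c $ j)"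
proof -
  have 1: "has_tame_gradient (\<lambda>x. softmax \<beta> (x + \<mu>)) (\<lambda>j x. gibbs \<beta> (x + \<mu>) j)"
    using has_tame_gradient_affine[OF softmax_tame[OF \<beta>], of 1 \<mu>] by simp
  have "softmax_residual \<beta> \<mu> c = (\<lambda>x. (softmax \<beta> (x + \<mu>) + 1 / \<beta>) + (- c) \<bullet> x)"
    by (simp add: softmax_residual_def fun_eq_iff)
  then show ?thesis
    using has_tame_gradient_add[OF has_tame_gradient_add[OF 1 has_tame_gradient_const[of "1 / \<beta>"]] has_tame_gradient_inner[of "- c"]]
    by simp
qed

section \<open>Monotonicity along the interpolation\<close>

text \<open>Telescoping over a uniform partition: the losses add up to \<open>e\<close> times the
  length of the interval, and \<open>e\<close> is arbitrary. Since \<open>\<delta>\<close> depends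
  on \<open>e\<close> alone, one mesh serves the whole interval.\<close>

lemma le_endpoints_of_local_almost_mono:
  fixes \<phi> :: "real \<Rightarrow> real"
  assumes ab: "a \<le> b"
    and loc: "\<And>e. 0 < e \<Longrightarrow> \<exists>\<delta>>0. \<forall>s t. a \<le> s \<longrightarrow> s < t \<longrightarrow> t \<le> b \<longrightarrow> t - s < \<delta> \<longrightarrow> \<phi> s - e * (t - s) \<le> \<phi> t"
  shows "\<phi> a \<le> \<phi> b"
proof (cases "a = b")
  case False
  then have ab: "a < b" using ab by simp
  show ?thesis
  proof (rule field_le_epsilon)
    fix e :: real assume "0 < e"
    then have e': "0 < e / (b - a)" using ab by simp
    obtain \<delta> where \<delta>: "0 < \<delta>" "\<And>s t. a \<le> s \<Longrightarrow> s < t \<Longrightarrow> t \<le> b \<Longrightarrow> t - s < \<delta> \<Longrightarrow> \<phi> s - e / (b - a) * (t - s) \<le> \<phi> t"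
      using loc[OF e'] by blast
    obtain n :: nat where n: "(b - a) / \<delta> < real n" using reals_Archimedean2 by blast
    have n0: "0 < real n" using n ab \<delta>(1) by (meson diff_gt_0_iff_gt divide_pos_pos less_trans)
    have h: "(b - a) / real n < \<delta>" using n n0 \<delta>(1) by (simp add: field_simps)
    define w where "w = (b - a) / real n"
    have w: "0 < w" "w < \<delta>" "real n * w = b - a" using h ab n0 by (simp_all add: w_def)
    define x where "x i = a + real i * w" for i :: nat
    have xn: "x n = b" "x 0 = a" using w by (simp_all add: x_def)
    have step: "x (Suc i) - x i = w" for i by (simp add: x_def distrib_right)
    have "- (e / real n) \<le> \<phi> (x (Suc i)) - \<phi> (x i)" if "i < n" for i
    proof -
      have "a \<le> x i" using w by (simp add: x_def)
      moreover have "x (Suc i) \<le> b"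
      proof -
        have "real (Suc i) * w \<le> real n * w"
          using that w by (intro mult_right_mono) auto
        then show ?thesis using w by (simp add: x_def)
      qed
      ultimately have "\<phi> (x i) - e / (b - a) * (x (Suc i) - x i) \<le> \<phi> (x (Suc i))"
        using \<delta>(2)[of "x i" "x (Suc i)"] w step[of i] by simp
      moreover have "e / (b - a) * w = e / real n" using ab n0 by (simp add: w_def)
      ultimately show ?thesis unfolding step by simp
    qed
    then have "(\<Sum>i<n. - (e / real n)) \<le> (\<Sum>i<n. \<phi> (x (Suc i)) - \<phi> (x i))" by (intro sum_mono) auto
    also have "\<dots> = \<phi> b - \<phi> a" by (subst sum_lessThan_telescope) (simp add: xn)
    finally show "\<phi> a \<le> \<phi> b + e" using n0 by simp
  qed
qed simp

text \<open>Translates between covariance entries and squared distances: as both weights have total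
  mass one, each diagonal entry is summed against a single weight.\<close>

lemma sum_dist_form:
  fixes D :: "'n::finite \<Rightarrow> 'n \<Rightarrow> real"
  assumes "sum p UNIV = 1" "sum q UNIV = 1"
  shows "(\<Sum>j\<in>UNIV. \<Sum>k\<in>UNIV. (D j j + D k k - 2 * D j k) * p j * q k) =
    (\<Sum>j\<in>UNIV. D j j * p j) + (\<Sum>j\<in>UNIV. D j j * q j) - 2 * (\<Sum>j\<in>UNIV. \<Sum>k\<in>UNIV. D j k * p j * q k)"
proof -
  have "(\<Sum>j\<in>UNIV. \<Sum>k\<in>UNIV. D j j * p j * q k) = (\<Sum>j\<in>UNIV. D j j * p j)"
    by (simp add: sum_distrib_left[symmetric] assms)
  moreover have "(\<Sum>j\<in>UNIV. \<Sum>k\<in>UNIV. D k k * p j * q k) = (\<Sum>k\<in>UNIV. D k k * q k)"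
  proof -
    have "(\<Sum>j\<in>UNIV. \<Sum>k\<in>UNIV. D k k * p j * q k) = (\<Sum>j\<in>UNIV. p j * (\<Sum>k\<in>UNIV. D k k * q k))"
      by (simp add: sum_distrib_left mult_ac)
    then show ?thesis by (simp add: sum_distrib_right[symmetric] assms)
  qed
  ultimately show ?thesis
    by (simp add: distrib_right left_diff_distrib sum.distrib sum_subtractf sum_distrib_left mult.assoc)
qed

text \<open>The contraction of \<open>D\<close> with the diagonal matrix of \<open>p\<close> minus
  its outer product, the shape of the softmax Hessian.\<close>

lemma sum_delta_form:
  fixes D :: "'n::finite \<Rightarrow> 'n \<Rightarrow> real"
  shows "(\<Sum>j\<in>UNIV. \<Sum>k\<in>UNIV. D j k * (p j * ((if j = k then 1 else 0) - p k))) =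
    (\<Sum>j\<in>UNIV. D j j * p j) - (\<Sum>j\<in>UNIV. \<Sum>k\<in>UNIV. D j k * p j * p k)"
proof -
  have "(\<Sum>k\<in>UNIV. D j k * (p j * ((if j = k then 1 else 0) - p k))) = D j j * p j - (\<Sum>k\<in>UNIV. D j k * p j * p k)" for j
  proof -
    have "(\<Sum>k\<in>UNIV. D j k * (p j * ((if j = k then 1 else 0) - p k))) = (\<Sum>k\<in>UNIV. (if j = k then D j k * p j else 0) - D j k * p j * p k)"
      by (intro sum.cong) (auto simp: algebra_simps)
    then show ?thesis by (simp add: sum_subtractf)
  qed
  then show ?thesis by (simp add: sum_subtractf)
qed

section \<open>The functional minimised over linear coefficients and its behaviour along the
  arc\<close>

locale gaussian_comparison = gaussian_pair M X N Y
  for M :: "'a measure" and X :: "'a \<Rightarrow> real ^ 'n" and N :: "'b measure" and Y :: "'b \<Rightarrow> real ^ 'n" +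
  fixes \<beta> :: real and \<mu> :: "real ^ 'n"
  assumes \<beta>: "0 < \<beta>" and \<mu>: "\<And>i. 0 \<le> \<mu> $ i"
    and dist_le: "\<And>i j. X.expectation (\<lambda>\<omega>. (X \<omega> $ i - X \<omega> $ j)\<^sup>2) \<le> Y.expectation (\<lambda>\<omega>. (Y \<omega> $ i - Y \<omega> $ j)\<^sup>2)"
begin

definition P :: "real ^ 'n \<Rightarrow> 'n \<Rightarrow> real" where
  "P x j = gibbs \<beta> (x + \<mu>) j"

abbreviation resid :: "real ^ 'n \<Rightarrow> real ^ 'n \<Rightarrow> real" where
  "resid \<equiv> softmax_residual \<beta> \<mu>"

text \<open>The squared canonical distance of \<open>Y\<close> minus that of \<open>X\<close>, so
  the comparison hypothesis is its nonnegativity.\<close>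

definition dd :: "'n \<Rightarrow> 'n \<Rightarrow> real" where
  "dd j k = cov_diff j j + cov_diff k k - 2 * cov_diff j k"

text \<open>The mean gradient of softmax along the arc, which turns out to be the vector of optimal
  linear coefficients.\<close>

definition mean_P :: "real \<Rightarrow> real ^ 'n" where
  "mean_P t = (\<chi> j. expectation (\<lambda>p. P (arc t p) j))"

definition \<phi> :: "real ^ 'n \<Rightarrow> real \<Rightarrow> real" where
  "\<phi> c t = expectation (\<lambda>p. (resid c (arc t p))\<^sup>2)"

text \<open>The Hessian of the squared residual: twice the outer product of its gradient, plus twice
  the residual times the softmax Hessian.\<close>

definition hess :: "real ^ 'n \<Rightarrow> 'n \<Rightarrow> 'n \<Rightarrow> real ^ 'n \<Rightarrow> real" where
  "hess c j k x = (2 * (P x k - c $ k)) * (P x j - c $ j) + 2 * resid c x * (\<beta> * (P x j * ((if j = k then 1 else 0) - P x k)))"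

lemma P_nonneg: "0 \<le> P x j" and P_le_1: "P x j \<le> 1" and sum_P: "sum (P x) UNIV = 1"
  using sum_gibbs[of \<beta> "x + \<mu>"] by (simp_all add: P_def gibbs_nonneg gibbs_le_1)

lemma resid_tame: "has_tame_gradient (resid c) (\<lambda>j x. P x j - c $ j)"
  using softmax_residual_tame[OF \<beta>] by (simp add: P_def)

lemma P_tame: "has_tame_gradient (\<lambda>x. P x j) (\<lambda>k x. \<beta> * (P x j * ((if j = k then 1 else 0) - P x k)))"
  using has_tame_gradient_affine[OF gibbs_tame[OF \<beta>, of j], of 1 \<mu>] by (simp add: P_def)

lemma grad_tame: "has_tame_gradient (\<lambda>x. 2 * resid c x * (P x j - c $ j)) (hess c j)"
proof -
  have 2: "has_tame_gradient (\<lambda>x. 2 * resid c x) (\<lambda>j x. 2 * (P x j - c $ j))"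
    using has_tame_gradient_add[OF resid_tame resid_tame, of c c] by simp
  have 3: "has_tame_gradient (\<lambda>x. P x j - c $ j) (\<lambda>k x. \<beta> * (P x j * ((if j = k then 1 else 0) - P x k)))"
    using has_tame_gradient_add[OF P_tame has_tame_gradient_const[of "- c $ j"]] by simp
  have "has_tame_gradient (\<lambda>x. 2 * resid c x * (P x j - c $ j)) (\<lambda>k x. 2 * (P x k - c $ k) * (P x j - c $ j) + 2 * resid c x * (\<beta> * (P x j * ((if j = k then 1 else 0) - P x k))))"
  proof (rule has_tame_gradient_mult_bounded[OF 2 3, where B = "1 + \<bar>c $ j\<bar> + \<beta>"])
    show "\<bar>P x j - c $ j\<bar> \<le> 1 + \<bar>c $ j\<bar> + \<beta>" for x
      using P_nonneg[of x j] P_le_1[of x j] \<beta> by linarith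
    show "\<bar>\<beta> * (P x j * ((if j = k then 1 else 0) - P x k))\<bar> \<le> 1 + \<bar>c $ j\<bar> + \<beta>" for k x
    proof -
      have "\<bar>\<beta> * (P x j * ((if j = k then 1 else 0) - P x k))\<bar> = \<beta> * \<bar>P x j * ((if j = k then 1 else 0) - P x k)\<bar>"
        using \<beta> by (simp add: abs_mult)
      also have "\<dots> \<le> \<beta> * 1"
        unfolding P_def by (intro mult_left_mono gibbs_gradient_bound) (use \<beta> in auto)
      finally show ?thesis by simp
    qed
  qed
  then show ?thesis by (simp add: hess_def[abs_def])
qed

lemma integrable_resid_power2: "integrable (M \<Otimes>\<^sub>M N) (\<lambda>p. (resid c (arc t p))\<^sup>2)"
proof -
  obtain C where C: "0 \<le> C" "\<And>p. \<bar>resid c (arc t p)\<bar> \<le> C * size p"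
    using tame_mix_bound[OF resid_tame] abs_cos_le_one abs_sin_le_one by metis
  note [measurable] = has_tame_gradient_measurable[OF resid_tame]
  show ?thesis
  proof (rule integrable_size_bound)
    show "\<bar>(resid c (arc t p))\<^sup>2\<bar> \<le> C\<^sup>2 * (size p)\<^sup>2" for p
      using power_mono[OF C(2)[of p], of 2] by (simp add: power_mult_distrib)
  qed measurable
qed

lemma integrable_P: "integrable (M \<Otimes>\<^sub>M N) (\<lambda>p. P (arc t p) j)"
  by (rule integrable_tame(3)[OF P_tame]) auto

text \<open>Integration by parts produces covariances times the mean gradient of the residual, and
  \<open>mean_P t\<close> is the choice of \<open>c\<close> that makes this mean zero.\<close>

lemma orthogonal_resid: "expectation (\<lambda>p. arc t p $ k * resid (mean_P t) (arc t p)) = 0"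
proof -
  have "expectation (\<lambda>p. P (arc t p) j - mean_P t $ j) = 0" for j
    by (simp add: integrable_P mean_P_def prob_space)
  then show ?thesis
    by (subst expectation_mix_mult[OF resid_tame]) auto
qed

text \<open>Pythagoras: another \<open>c\<close> changes the residual by a linear form in the arc
  vector, to which the optimal residual is orthogonal.\<close>

lemma mean_P_minimizes: "\<phi> (mean_P t) t \<le> \<phi> c t"
proof -
  define e where "e = mean_P t - c"
  let ?r = "\<lambda>p. resid (mean_P t) (arc t p)"
  have i: "integrable (M \<Otimes>\<^sub>M N) (\<lambda>p. arc t p $ k * ?r p)" for k
  proof -
    have "arc t p $ k * ?r p = cos t * (X (fst p) $ k * ?r p) + sin t * (Y (snd p) $ k * ?r p)" for p
      by (simp add: mix_def[of "cos t"] algebra_simps)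
    then show ?thesis using integrable_tame(1,2)[OF resid_tame, of "cos t" "sin t"] by simp
  qed
  \<comment> \<open>The inserted cross term has mean zero; with it, the integrand differs from that
    of \<open>c\<close> only by a missing square, so the comparison is pointwise.\<close>
  have "\<phi> (mean_P t) t = expectation (\<lambda>p. (?r p)\<^sup>2 + 2 * (\<Sum>k\<in>UNIV. e $ k * (arc t p $ k * ?r p)))"
    using i by (simp add: \<phi>_def integrable_resid_power2 orthogonal_resid)
  also have "\<dots> \<le> expectation (\<lambda>p. (resid c (arc t p))\<^sup>2)"
  proof (rule Bochner_Integration.integral_mono)
    show "(?r p)\<^sup>2 + 2 * (\<Sum>k\<in>UNIV. e $ k * (arc t p $ k * ?r p)) \<le> (resid c (arc t p))\<^sup>2" for p
    proof -
      have "(\<Sum>k\<in>UNIV. e $ k * (arc t p $ k * ?r p)) = (e \<bullet> arc t p) * ?r p"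
        by (simp add: inner_vec_def sum_distrib_right mult_ac)
      moreover have "resid c (arc t p) = ?r p + e \<bullet> arc t p"
        by (simp add: softmax_residual_def e_def inner_diff_left)
      moreover have "(?r p + e \<bullet> arc t p)\<^sup>2 = (?r p)\<^sup>2 + 2 * ((e \<bullet> arc t p) * ?r p) + (e \<bullet> arc t p)\<^sup>2"
        by (simp add: power2_eq_square algebra_simps)
      ultimately show ?thesis by simp
    qed
  qed (use i integrable_resid_power2 in auto)
  finally show ?thesis by (simp add: \<phi>_def)
qed

lemma \<phi>_derivative:
  "(\<phi> c has_real_derivative sin t * cos t * (\<Sum>j\<in>UNIV. \<Sum>k\<in>UNIV. cov_diff j k * expectation (\<lambda>p. hess c j k (arc t p)))) (at t)"
  unfolding \<phi>_def[abs_def]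
proof (rule arc_derivative[OF _ grad_tame integrable_resid_power2])
  fix x
  have "(\<lambda>h. real 2 * (\<Sum>j\<in>UNIV. (P x j - c $ j) * h $ j) * resid c x ^ (2 - 1)) = (\<lambda>h. \<Sum>j\<in>UNIV. 2 * resid c x * (P x j - c $ j) * h $ j)"
    unfolding sum_distrib_left sum_distrib_right by (intro ext sum.cong) auto
  then show "((\<lambda>x. (resid c x)\<^sup>2) has_derivative (\<lambda>h. \<Sum>j\<in>UNIV. 2 * resid c x * (P x j - c $ j) * h $ j)) (at x)"
    using has_derivative_power[OF has_tame_gradient_derivative[OF resid_tame[of c], of x], where n = 2] by simp
qed

lemma cov_diff_sym: "cov_diff j k = cov_diff k j"
  by (simp add: cov_diff_def mult.commute)

lemma dd_nonneg: "0 \<le> dd j k"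
proof -
  have x: "X.expectation (\<lambda>\<omega>. (X \<omega> $ j - X \<omega> $ k)\<^sup>2) = X.expectation (\<lambda>\<omega>. X \<omega> $ j * X \<omega> $ j) + X.expectation (\<lambda>\<omega>. X \<omega> $ k * X \<omega> $ k) - 2 * X.expectation (\<lambda>\<omega>. X \<omega> $ j * X \<omega> $ k)"
  proof -
    have "(X \<omega> $ j - X \<omega> $ k)\<^sup>2 = X \<omega> $ j * X \<omega> $ j + X \<omega> $ k * X \<omega> $ k - 2 * (X \<omega> $ j * X \<omega> $ k)" for \<omega>
      by (simp add: power2_eq_square algebra_simps)
    then show ?thesis by (simp add: X.integrable_nth_mult)
  qed
  have y: "Y.expectation (\<lambda>\<omega>. (Y \<omega> $ j - Y \<omega> $ k)\<^sup>2) = Y.expectation (\<lambda>\<omega>. Y \<omega> $ j * Y \<omega> $ j) + Y.expectation (\<lambda>\<omega>. Y \<omega> $ k * Y \<omega> $ k) - 2 * Y.expectation (\<lambda>\<omega>. Y \<omega> $ j * Y \<omega> $ k)"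
  proof -
    have "(Y \<omega> $ j - Y \<omega> $ k)\<^sup>2 = Y \<omega> $ j * Y \<omega> $ j + Y \<omega> $ k * Y \<omega> $ k - 2 * (Y \<omega> $ j * Y \<omega> $ k)" for \<omega>
      by (simp add: power2_eq_square algebra_simps)
    then show ?thesis by (simp add: Y.integrable_nth_mult)
  qed
  show ?thesis using dist_le[of j k] unfolding x y dd_def cov_diff_def by (simp add: algebra_simps)
qed

text \<open>The place where \<open>\<mu> \<ge> 0\<close> enters: each \<open>x $ j\<close> lies
  below \<open>x $ j + \<mu> $ j\<close> and hence below the softmax, and averaging with the weights
  \<open>c\<close> preserves this.\<close>

lemma softmax_ge_convex:
  assumes c: "\<And>j. 0 \<le> c $ j" "(\<Sum>j\<in>UNIV. c $ j) = 1"
  shows "c \<bullet> x \<le> softmax \<beta> (x + \<mu>)"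
proof -
  have "c \<bullet> x \<le> (\<Sum>j\<in>UNIV. c $ j * softmax \<beta> (x + \<mu>))"
    unfolding inner_vec_def
  proof (rule sum_mono)
    fix j
    have "x $ j \<le> softmax \<beta> (x + \<mu>)" using softmax_ge[OF \<beta>, of "x + \<mu>" j] \<mu>[of j] by simp
    then show "inner (c $ j) (x $ j) \<le> c $ j * softmax \<beta> (x + \<mu>)" using c(1) by (simp add: mult_left_mono)
  qed
  then show ?thesis by (simp add: sum_distrib_right[symmetric] c)
qed

text \<open>The difference of the two sides is \<open>\<beta> * r\<close> times the contraction of
  \<open>dd\<close> with the weights \<open>P x\<close> taken twice, where \<open>r\<close> is the
  gap between softmax and linear part; both factors are nonnegative.\<close>

lemma hess_contraction_ge:
  assumes c: "\<And>j. 0 \<le> c $ j" "(\<Sum>j\<in>UNIV. c $ j) = 1"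
  shows "2 * (\<Sum>j\<in>UNIV. \<Sum>k\<in>UNIV. dd j k * P x j * c $ k) - (\<Sum>j\<in>UNIV. \<Sum>k\<in>UNIV. dd j k * c $ j * c $ k)
    \<le> (\<Sum>j\<in>UNIV. \<Sum>k\<in>UNIV. cov_diff j k * hess c j k x)"
proof -
  let ?D = cov_diff and ?p = "P x" and ?c = "\<lambda>j. c $ j"
  define QPP where "QPP = (\<Sum>j\<in>UNIV. \<Sum>k\<in>UNIV. ?D j k * ?p j * ?p k)"
  define QPc where "QPc = (\<Sum>j\<in>UNIV. \<Sum>k\<in>UNIV. ?D j k * ?p j * ?c k)"
  define Qcc where "Qcc = (\<Sum>j\<in>UNIV. \<Sum>k\<in>UNIV. ?D j k * ?c j * ?c k)"
  define A where "A = (\<Sum>j\<in>UNIV. ?D j j * ?p j)"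
  define B where "B = (\<Sum>j\<in>UNIV. ?D j j * ?c j)"
  define r where "r = softmax \<beta> (x + \<mu>) - c \<bullet> x"
  have r: "0 \<le> r" using softmax_ge_convex[OF c, of x] by (simp add: r_def)
  \<comment> \<open>The summand \<open>1 / \<beta>\<close> contributes exactly \<open>1\<close>
    here. The \<open>QPP\<close> that it brings from the softmax Hessian cancels the one from the
    outer product of gradients.\<close>
  have br: "\<beta> * resid c x = 1 + \<beta> * r" using \<beta> by (simp add: softmax_residual_def r_def field_simps)
  have QcP: "(\<Sum>j\<in>UNIV. \<Sum>k\<in>UNIV. ?D j k * ?c j * ?p k) = QPc"
    unfolding QPc_def by (subst sum.swap) (simp add: cov_diff_sym mult_ac)
  have "cov_diff j k * hess c j k x =
     2 * (?D j k * ?p j * ?p k - ?D j k * ?p j * ?c k - ?D j k * ?c j * ?p k + ?D j k * ?c j * ?c k)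
     + 2 * (1 + \<beta> * r) * (?D j k * (?p j * ((if j = k then 1 else 0) - ?p k)))" for j k
    unfolding hess_def br[symmetric] by (simp add: algebra_simps)
  then have "(\<Sum>j\<in>UNIV. \<Sum>k\<in>UNIV. cov_diff j k * hess c j k x) =
     2 * (QPP - QPc - QPc + Qcc) + 2 * (1 + \<beta> * r) * (A - QPP)"
    by (simp add: sum.distrib sum_subtractf sum_distrib_left[symmetric] sum_delta_form QcP
        QPP_def[symmetric] QPc_def[symmetric] Qcc_def[symmetric] A_def[symmetric])
  moreover have "(\<Sum>j\<in>UNIV. \<Sum>k\<in>UNIV. dd j k * P x j * c $ k) = A + B - 2 * QPc"
    using sum_dist_form[OF sum_P[of x] c(2), of ?D] by (simp add: dd_def A_def B_def QPc_def)
  moreover have "(\<Sum>j\<in>UNIV. \<Sum>k\<in>UNIV. dd j k * c $ j * c $ k) = B + B - 2 * Qcc"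
    using sum_dist_form[OF c(2) c(2), of ?D] by (simp add: dd_def B_def Qcc_def)
  moreover have "0 \<le> A + A - 2 * QPP"
  proof -
    have "0 \<le> (\<Sum>j\<in>UNIV. \<Sum>k\<in>UNIV. dd j k * P x j * P x k)"
      by (intro sum_nonneg mult_nonneg_nonneg dd_nonneg P_nonneg)
    then show ?thesis
      using sum_dist_form[OF sum_P[of x] sum_P[of x], of ?D] by (simp add: dd_def A_def QPP_def)
  qed
  then have "0 \<le> \<beta> * r * (A + A - 2 * QPP)" using \<beta> r by simp
  ultimately show ?thesis by (simp add: algebra_simps)
qed

lemma mean_P_simplex: "0 \<le> mean_P t $ j" "(\<Sum>j\<in>UNIV. mean_P t $ j) = 1"
proof -
  show "0 \<le> mean_P t $ j" by (simp add: mean_P_def P_nonneg)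
  have "(\<Sum>j\<in>UNIV. mean_P t $ j) = expectation (\<lambda>p. sum (P (arc t p)) UNIV)"
    by (simp add: mean_P_def integrable_P)
  then show "(\<Sum>j\<in>UNIV. mean_P t $ j) = 1" by (simp add: sum_P prob_space)
qed

text \<open>Taking expectations replaces \<open>P\<close> by \<open>mean_P t\<close> in the
  pointwise bound. For \<open>s = t\<close> this leaves a nonnegative form; otherwise the
  displacement of \<open>mean_P\<close> is paid for, with weights \<open>c $ k\<close> at most
  one.\<close>

lemma expected_hess_contraction_ge:
  "- 2 * (\<Sum>j\<in>UNIV. \<Sum>k\<in>UNIV. dd j k * \<bar>mean_P t $ j - mean_P s $ j\<bar>)
    \<le> (\<Sum>j\<in>UNIV. \<Sum>k\<in>UNIV. cov_diff j k * expectation (\<lambda>p. hess (mean_P s) j k (arc t p)))"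
proof -
  let ?c = "mean_P s" and ?m = "mean_P t"
  have ih: "integrable (M \<Otimes>\<^sub>M N) (\<lambda>p. hess ?c j k (arc t p))" for j k
    by (rule integrable_tame(4)[OF grad_tame]) auto
  have c1: "?c $ k \<le> 1" for k
    using member_le_sum[of k UNIV "\<lambda>k. ?c $ k"] mean_P_simplex[of s] by simp
  have "- (dd j k * \<bar>?m $ j - ?c $ j\<bar>) \<le> dd j k * (?m $ j - ?c $ j) * ?c $ k" for j k
  proof -
    have "\<bar>?m $ j - ?c $ j\<bar> * ?c $ k \<le> \<bar>?m $ j - ?c $ j\<bar>"
      using c1 mean_P_simplex(1)[of s k] by (intro mult_right_le_one_le) auto
    then have "- \<bar>?m $ j - ?c $ j\<bar> \<le> (?m $ j - ?c $ j) * ?c $ k"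
      using mean_P_simplex(1)[of s k] abs_mult_pos by (smt (verit) mult_minus_left mult_right_mono)
    from mult_left_mono[OF this dd_nonneg[of j k]] show ?thesis by (simp add: mult.assoc)
  qed
  then have "- (\<Sum>j\<in>UNIV. \<Sum>k\<in>UNIV. dd j k * \<bar>?m $ j - ?c $ j\<bar>) \<le> (\<Sum>j\<in>UNIV. \<Sum>k\<in>UNIV. dd j k * (?m $ j - ?c $ j) * ?c $ k)"
    unfolding sum_negf[symmetric] by (intro sum_mono)
  also have "\<dots> = (\<Sum>j\<in>UNIV. \<Sum>k\<in>UNIV. dd j k * ?m $ j * ?c $ k) - (\<Sum>j\<in>UNIV. \<Sum>k\<in>UNIV. dd j k * ?c $ j * ?c $ k)"
    by (simp add: sum_subtractf[symmetric] algebra_simps)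
  finally have le: "- 2 * (\<Sum>j\<in>UNIV. \<Sum>k\<in>UNIV. dd j k * \<bar>?m $ j - ?c $ j\<bar>) \<le>
     2 * (\<Sum>j\<in>UNIV. \<Sum>k\<in>UNIV. dd j k * ?m $ j * ?c $ k) - 2 * (\<Sum>j\<in>UNIV. \<Sum>k\<in>UNIV. dd j k * ?c $ j * ?c $ k)"
    by simp
  \<comment> \<open>Only one of the two copies subtracted in \<open>le\<close> occurs in the
    pointwise bound; the other is discarded by its sign.\<close>
  have "0 \<le> (\<Sum>j\<in>UNIV. \<Sum>k\<in>UNIV. dd j k * ?c $ j * ?c $ k)"
    by (intro sum_nonneg mult_nonneg_nonneg dd_nonneg mean_P_simplex)
  with le have "- 2 * (\<Sum>j\<in>UNIV. \<Sum>k\<in>UNIV. dd j k * \<bar>?m $ j - ?c $ j\<bar>) \<le>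
     2 * (\<Sum>j\<in>UNIV. \<Sum>k\<in>UNIV. dd j k * ?m $ j * ?c $ k) - (\<Sum>j\<in>UNIV. \<Sum>k\<in>UNIV. dd j k * ?c $ j * ?c $ k)"
    by simp
  also have "\<dots> = expectation (\<lambda>p. 2 * (\<Sum>j\<in>UNIV. \<Sum>k\<in>UNIV. dd j k * P (arc t p) j * ?c $ k) - (\<Sum>j\<in>UNIV. \<Sum>k\<in>UNIV. dd j k * ?c $ j * ?c $ k))"
    by (simp add: integrable_P prob_space) (simp add: mean_P_def)
  also have "\<dots> \<le> expectation (\<lambda>p. \<Sum>j\<in>UNIV. \<Sum>k\<in>UNIV. cov_diff j k * hess ?c j k (arc t p))"
    by (intro Bochner_Integration.integral_mono hess_contraction_ge mean_P_simplex)
      (auto simp: integrable_P ih)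
  also have "\<dots> = (\<Sum>j\<in>UNIV. \<Sum>k\<in>UNIV. cov_diff j k * expectation (\<lambda>p. hess ?c j k (arc t p)))"
    by (simp add: ih)
  finally show ?thesis .
qed

lemma continuous_mean_P: "continuous_on S (\<lambda>t. mean_P t $ j)"
proof (rule continuous_on_subset[OF _ subset_UNIV], rule continuous_at_imp_continuous_on, rule ballI)
  fix t
  note [measurable] = has_tame_gradient_measurable[OF P_tame]
  show "isCont (\<lambda>t. mean_P t $ j) t"
    unfolding continuous_at_sequentially comp_def
  proof (intro allI impI)
    fix u :: "nat \<Rightarrow> real" assume u: "u \<longlonglongrightarrow> t"
    have "(\<lambda>n. expectation (\<lambda>p. P (arc (u n) p) j)) \<longlonglongrightarrow> expectation (\<lambda>p. P (arc t p) j)"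
    proof (rule integral_dominated_convergence[where w = "\<lambda>_. 1"])
      show "AE p in M \<Otimes>\<^sub>M N. (\<lambda>n. P (arc (u n) p) j) \<longlonglongrightarrow> P (arc t p) j"
      proof (rule AE_I2)
        fix p
        have "isCont (\<lambda>x. P x j) (arc t p)"
          using has_tame_gradient_continuous[OF P_tame] by (simp add: continuous_on_eq_continuous_at)
        moreover have "(\<lambda>n. arc (u n) p) \<longlonglongrightarrow> arc t p"
          unfolding mix_def by (intro tendsto_intros u)
        ultimately show "(\<lambda>n. P (arc (u n) p) j) \<longlonglongrightarrow> P (arc t p) j" by (rule isCont_tendsto_compose)
      qed
      show "AE p in M \<Otimes>\<^sub>M N. norm (P (arc (u n) p) j) \<le> 1" for n
        by (simp add: P_nonneg P_le_1)
    qed auto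
    then show "(\<lambda>n. mean_P (u n) $ j) \<longlonglongrightarrow> mean_P t $ j" by (simp add: mean_P_def)
  qed
qed

text \<open>On a short interval the coefficients are frozen at their value for the right end, where
  the mean value theorem applies in \<open>t\<close> alone. Uniform continuity of
  \<open>mean_P\<close> makes the possible loss a small multiple of the length.\<close>

lemma \<phi>_endpoints: "\<phi> (mean_P 0) 0 \<le> \<phi> (mean_P (pi / 2)) (pi / 2)"
proof (rule le_endpoints_of_local_almost_mono[where \<phi> = "\<lambda>t. \<phi> (mean_P t) t"])
  fix e :: real assume e: "0 < e"
  \<comment> \<open>\<open>K\<close> measures how strongly the bound on the contraction reacts to a
    displacement of \<open>mean_P\<close>; dividing by \<open>K + 1\<close> below also covers
    \<open>K = 0\<close>.\<close>
  define K where "K = 2 * (\<Sum>j\<in>UNIV. \<Sum>k\<in>UNIV. dd j k)"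
  have K: "0 \<le> K" by (auto simp: K_def intro!: sum_nonneg dd_nonneg)
  define e' where "e' = e / (K + 1)"
  have e': "0 < e'" "K * e' \<le> e" using e K by (auto simp: e'_def field_simps)
  have "\<forall>j. \<exists>\<delta>>0. \<forall>s\<in>{0..pi/2}. \<forall>t\<in>{0..pi/2}. dist t s < \<delta> \<longrightarrow> dist (mean_P t $ j) (mean_P s $ j) < e'"
    using compact_uniformly_continuous[OF continuous_mean_P compact_Icc] e'(1)
    unfolding uniformly_continuous_on_def by metis
  then obtain \<delta> where \<delta>: "\<And>j. 0 < \<delta> j"
    "\<And>j s t. s \<in> {0..pi/2} \<Longrightarrow> t \<in> {0..pi/2} \<Longrightarrow> dist t s < \<delta> j \<Longrightarrow> dist (mean_P t $ j) (mean_P s $ j) < e'"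
    by metis
  define \<delta>0 where "\<delta>0 = Min (range \<delta>)"
  have \<delta>0: "0 < \<delta>0" "\<And>j. \<delta>0 \<le> \<delta> j" by (auto simp: \<delta>0_def \<delta>)
  show "\<exists>\<delta>>0. \<forall>s t. 0 \<le> s \<longrightarrow> s < t \<longrightarrow> t \<le> pi / 2 \<longrightarrow> t - s < \<delta> \<longrightarrow> \<phi> (mean_P s) s - e * (t - s) \<le> \<phi> (mean_P t) t"
  proof (intro exI[of _ \<delta>0] conjI allI impI \<delta>0(1))
    fix s t assume st: "0 \<le> s" "s < t" "t \<le> pi / 2" "t - s < \<delta>0"
    let ?c = "mean_P t"
    define V where "V u = (\<Sum>j\<in>UNIV. \<Sum>k\<in>UNIV. cov_diff j k * expectation (\<lambda>p. hess ?c j k (arc u p)))" for u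
    have "\<exists>u>s. u < t \<and> \<phi> ?c t - \<phi> ?c s = (t - s) * (sin u * cos u * V u)"
      unfolding V_def by (rule MVT2[OF st(2)]) (rule \<phi>_derivative)
    then obtain u where u: "s < u" "u < t" "\<phi> ?c t - \<phi> ?c s = (t - s) * (sin u * cos u * V u)" by blast
    have close: "\<bar>mean_P u $ j - mean_P t $ j\<bar> \<le> e'" for j
      using \<delta>(2)[of t u j] \<delta>0(2)[of j] st u by (auto simp: dist_real_def)
    have "(\<Sum>j\<in>UNIV. \<Sum>k\<in>UNIV. dd j k * \<bar>mean_P u $ j - mean_P t $ j\<bar>) \<le> (\<Sum>j\<in>UNIV. \<Sum>k\<in>UNIV. dd j k * e')"
      by (intro sum_mono mult_left_mono close dd_nonneg)
    then have "2 * (\<Sum>j\<in>UNIV. \<Sum>k\<in>UNIV. dd j k * \<bar>mean_P u $ j - mean_P t $ j\<bar>) \<le> K * e'"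
      by (simp add: K_def sum_distrib_right)
    then have V: "- e \<le> V u"
      using expected_hess_contraction_ge[of u t] e'(2) unfolding V_def by linarith
    \<comment> \<open>Staying on a quarter circle keeps the prefactor \<open>sin u * cos u\<close>
      between zero and one.\<close>
    have sc: "0 \<le> sin u" "0 \<le> cos u" using u st by (auto intro!: sin_ge_zero cos_ge_zero)
    have "sin u * cos u * (- e) \<le> sin u * cos u * V u" using V sc by (intro mult_left_mono) auto
    moreover have "sin u * cos u * e \<le> 1 * e"
      using e sc by (intro mult_right_mono mult_le_one) auto
    ultimately have "- e \<le> sin u * cos u * V u" by simp
    then have "(t - s) * (- e) \<le> (t - s) * (sin u * cos u * V u)" using st by (intro mult_left_mono) auto
    then have "\<phi> ?c s - e * (t - s) \<le> \<phi> ?c t" using u(3) by (simp add: algebra_simps)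
    then show "\<phi> (mean_P s) s - e * (t - s) \<le> \<phi> (mean_P t) t"
      using mean_P_minimizes[of s ?c] by linarith
  qed
qed simp

end

section \<open>Orthogonal projections\<close>

lemma L2_mult_integrable:
  assumes "f \<in> L2 M" "g \<in> L2 M"
  shows "integrable M (\<lambda>\<omega>. f \<omega> * g \<omega>)"
proof -
  have [measurable]: "f \<in> borel_measurable M" "g \<in> borel_measurable M" using assms by (auto simp: L2_def)
  have i: "integrable M (\<lambda>\<omega>. (f \<omega>)\<^sup>2 + (g \<omega>)\<^sup>2)" using assms by (auto simp: L2_def)
  show ?thesis
  proof (rule Bochner_Integration.integrable_bound[OF i], measurable, rule AE_I2)
    fix \<omega>
    have "2 * \<bar>f \<omega> * g \<omega>\<bar> \<le> (f \<omega>)\<^sup>2 + (g \<omega>)\<^sup>2"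
      using sum_squares_bound[of "\<bar>f \<omega>\<bar>" "\<bar>g \<omega>\<bar>"] by (simp add: abs_mult mult.assoc)
    then show "norm (f \<omega> * g \<omega>) \<le> norm ((f \<omega>)\<^sup>2 + (g \<omega>)\<^sup>2)"
      using abs_ge_zero[of "f \<omega> * g \<omega>"] abs_ge_self[of "(f \<omega>)\<^sup>2 + (g \<omega>)\<^sup>2"]
      unfolding real_norm_def by linarith
  qed
qed

lemma L2_diff:
  assumes "f \<in> L2 M" "g \<in> L2 M"
  shows "(\<lambda>\<omega>. f \<omega> - g \<omega>) \<in> L2 M"
proof -
  have "(f \<omega> - g \<omega>)\<^sup>2 = (f \<omega>)\<^sup>2 - 2 * (f \<omega> * g \<omega>) + (g \<omega>)\<^sup>2" for \<omega>
    by (simp add: power2_eq_square algebra_simps)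
  then show ?thesis using assms L2_mult_integrable[OF assms] by (auto simp: L2_def)
qed

text \<open>\<open>orth_proj\<close> is a choice, so only its defining property is available;
  \<open>W\<close> shows that the choice succeeds. The difference \<open>d\<close> of the two
  candidates lies in the complement and, by both defining properties, is orthogonal to
  itself.\<close>

lemma orth_proj_unique:
  assumes H: "H \<subseteq> L2 M" and Z: "Z \<in> L2 M" and W: "W \<in> orth_complement M H"
    and ZW: "\<And>v. v \<in> orth_complement M H \<Longrightarrow> (LINT \<omega>|M. (Z \<omega> - W \<omega>) * v \<omega>) = 0"
  shows "orth_proj M (orth_complement M H) Z \<in> borel_measurable M"
    and "AE \<omega> in M. orth_proj M (orth_complement M H) Z \<omega> = W \<omega>"
proof -
  define V where "V = orth_complement M H"
  define U where "U = orth_proj M V Z"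
  have "U \<in> V \<and> (\<forall>v\<in>V. (LINT \<omega>|M. (Z \<omega> - U \<omega>) * v \<omega>) = 0)"
    unfolding U_def orth_proj_def by (rule someI[of _ W]) (use W ZW in \<open>auto simp: V_def\<close>)
  then have U: "U \<in> V" and ZU: "\<And>v. v \<in> V \<Longrightarrow> (LINT \<omega>|M. (Z \<omega> - U \<omega>) * v \<omega>) = 0" by auto
  have L2: "U \<in> L2 M" "W \<in> L2 M" using U W by (auto simp: V_def orth_complement_def)
  then show "orth_proj M (orth_complement M H) Z \<in> borel_measurable M"
    by (simp add: U_def V_def L2_def)
  define d where "d \<omega> = U \<omega> - W \<omega>" for \<omega>
  have dL2: "d \<in> L2 M" unfolding d_def by (rule L2_diff[OF L2])
  have "d \<in> V"
    unfolding V_def orth_complement_def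
  proof (intro CollectI conjI ballI dL2)
    fix h assume "h \<in> H"
    then have "h \<in> L2 M" "(LINT \<omega>|M. U \<omega> * h \<omega>) = 0" "(LINT \<omega>|M. W \<omega> * h \<omega>) = 0"
      using H U W by (auto simp: V_def orth_complement_def)
    then show "(LINT \<omega>|M. d \<omega> * h \<omega>) = 0"
      using L2_mult_integrable[OF L2(1)] L2_mult_integrable[OF L2(2)] by (simp add: d_def left_diff_distrib)
  qed
  then have "(LINT \<omega>|M. (Z \<omega> - U \<omega>) * d \<omega>) = 0" "(LINT \<omega>|M. (Z \<omega> - W \<omega>) * d \<omega>) = 0"
    using ZU ZW by (auto simp: V_def)
  moreover have "(LINT \<omega>|M. (d \<omega>)\<^sup>2) = (LINT \<omega>|M. (Z \<omega> - W \<omega>) * d \<omega> - (Z \<omega> - U \<omega>) * d \<omega>)"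
    by (simp add: d_def power2_eq_square algebra_simps)
  moreover have "integrable M (\<lambda>\<omega>. (Z \<omega> - W \<omega>) * d \<omega>)" "integrable M (\<lambda>\<omega>. (Z \<omega> - U \<omega>) * d \<omega>)"
    by (rule L2_mult_integrable[OF L2_diff[OF Z L2(2)] dL2], rule L2_mult_integrable[OF L2_diff[OF Z L2(1)] dL2])
  ultimately have "(LINT \<omega>|M. (d \<omega>)\<^sup>2) = 0" by simp
  then have "AE \<omega> in M. (d \<omega>)\<^sup>2 = 0"
    using dL2 by (subst (asm) integral_nonneg_eq_0_iff_AE) (auto simp: L2_def)
  then show "AE \<omega> in M. orth_proj M (orth_complement M H) Z \<omega> = W \<omega>"
    by eventually_elim (simp add: d_def U_def V_def)
qed

section \<open>Growth and measurability of the maximum, and its distance from softmax\<close>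

lemma abs_MAX_le_norm: "\<bar>MAX i. x $ i\<bar> \<le> norm x" for x :: "real ^ 'n"
proof -
  have c: "x $ i \<le> norm x" "- norm x \<le> x $ i" for i
    using component_le_norm_cart[of x i] by linarith+
  have "(MAX i. x $ i) \<le> norm x" using c(1) by simp
  moreover have "- norm x \<le> (MAX i. x $ i)"
    using c(2)[of undefined] by (rule order_trans) simp
  ultimately show ?thesis by linarith
qed

lemma softmax_MAX:
  fixes x :: "real ^ 'n"
  assumes "0 < \<beta>"
  shows "(MAX i. x $ i) \<le> softmax \<beta> x" "softmax \<beta> x \<le> (MAX i. x $ i) + ln (real CARD('n)) / \<beta>"
  using softmax_ge[OF assms, of x] by (auto intro!: softmax_le[OF assms])

lemma borel_measurable_MAX [measurable]: "(\<lambda>x :: real ^ 'n. MAX i. x $ i) \<in> borel_measurable borel"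
  by (intro borel_measurable_Max) auto

section \<open>Projections of functions of a Gaussian vector, and the limit of large inverse
  temperature\<close>

context centered_gaussian
begin

lemma L2_linear_growth:
  fixes h :: "real ^ 'n \<Rightarrow> real"
  assumes [measurable]: "h \<in> borel_measurable borel" and h: "\<And>x. \<bar>h x\<bar> \<le> C * (1 + norm x)"
  shows "(\<lambda>\<omega>. h (X \<omega>)) \<in> L2 M"
proof -
  have "integrable M (\<lambda>\<omega>. (h (X \<omega>))\<^sup>2)"
  proof (rule integrable_quadratic_growth)
    show "\<bar>(h (X \<omega>))\<^sup>2\<bar> \<le> C\<^sup>2 * (1 + norm (X \<omega>))\<^sup>2" for \<omega>
      using power_mono[OF h[of "X \<omega>"], of 2] by (simp add: power_mult_distrib)
  qed measurable
  then show ?thesis by (simp add: L2_def)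
qed

text \<open>The normal equations \<open>orth\<close> identify
  \<open>h (X \<omega>) - c \<bullet> X \<omega>\<close> as the projection. Taking \<open>c\<close>
  as given covers singular covariances, where it is not unique; \<open>a\<close> will be
  \<open>1 / \<beta>\<close> or \<open>0\<close>.\<close>

lemma orth_proj_gaussian_span:
  fixes h :: "real ^ 'n \<Rightarrow> real"
  assumes [measurable]: "h \<in> borel_measurable borel" and h: "\<And>x. \<bar>h x\<bar> \<le> C * (1 + norm x)"
    and orth: "\<And>k. expectation (\<lambda>\<omega>. X \<omega> $ k * (h (X \<omega>) - c \<bullet> X \<omega>)) = 0"
  shows "expectation (\<lambda>\<omega>. (orth_proj M (orth_complement M (gaussian_span X)) (\<lambda>\<omega>. h (X \<omega>)) \<omega> + a)\<^sup>2) =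
    expectation (\<lambda>\<omega>. (h (X \<omega>) + a - c \<bullet> X \<omega>)\<^sup>2)"
proof -
  have lin: "(\<lambda>\<omega>. u \<bullet> X \<omega>) \<in> L2 M" for u
  proof (rule L2_linear_growth)
    show "\<bar>u \<bullet> x\<bar> \<le> norm u * (1 + norm x)" for x
      using Cauchy_Schwarz_ineq2[of u x] by (simp add: distrib_left add_increasing)
  qed measurable
  have span: "gaussian_span X = range (\<lambda>u \<omega>. u \<bullet> X \<omega>)"
  proof (safe; clarsimp simp: gaussian_span_def)
    show "(\<lambda>\<omega>. \<Sum>i\<in>UNIV. b i * X \<omega> $ i) \<in> range (\<lambda>u \<omega>. u \<bullet> X \<omega>)" for b
      by (rule range_eqI[of _ _ "\<chi> i. b i"]) (simp add: inner_vec_def)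
    show "\<exists>b. (\<lambda>\<omega>. u \<bullet> X \<omega>) = (\<lambda>\<omega>. \<Sum>i\<in>UNIV. b i * X \<omega> $ i)" for u
      by (rule exI[of _ "\<lambda>i. u $ i"]) (simp add: inner_vec_def)
  qed
  have Z: "(\<lambda>\<omega>. h (X \<omega>)) \<in> L2 M" by (rule L2_linear_growth[OF assms(1) h])
  have WL2: "(\<lambda>\<omega>. h (X \<omega>) - c \<bullet> X \<omega>) \<in> L2 M" by (rule L2_diff[OF Z lin])
  have W: "(\<lambda>\<omega>. h (X \<omega>) - c \<bullet> X \<omega>) \<in> orth_complement M (gaussian_span X)"
    unfolding orth_complement_def span
  proof (intro CollectI conjI ballI WL2; clarify)
    fix u
    have "integrable M (\<lambda>\<omega>. X \<omega> $ k * (h (X \<omega>) - c \<bullet> X \<omega>))" for k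
      using L2_mult_integrable[OF lin[of "axis k 1"] WL2] by (simp add: inner_axis')
    then have "expectation (\<lambda>\<omega>. \<Sum>k\<in>UNIV. u $ k * (X \<omega> $ k * (h (X \<omega>) - c \<bullet> X \<omega>))) = 0"
      by (simp add: orth)
    then show "expectation (\<lambda>\<omega>. (h (X \<omega>) - c \<bullet> X \<omega>) * (u \<bullet> X \<omega>)) = 0"
      by (simp add: inner_vec_def[of u] sum_distrib_left mult_ac)
  qed
  have ZW: "expectation (\<lambda>\<omega>. (h (X \<omega>) - (h (X \<omega>) - c \<bullet> X \<omega>)) * v \<omega>) = 0"
    if "v \<in> orth_complement M (gaussian_span X)" for v
  proof -
    have "expectation (\<lambda>\<omega>. v \<omega> * (c \<bullet> X \<omega>)) = 0" using that by (auto simp: orth_complement_def span)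
    then show ?thesis by (simp add: mult.commute)
  qed
  have H: "gaussian_span X \<subseteq> L2 M" using lin by (auto simp: span)
  have *: "orth_proj M (orth_complement M (gaussian_span X)) (\<lambda>\<omega>. h (X \<omega>)) \<in> borel_measurable M"
    "AE \<omega> in M. orth_proj M (orth_complement M (gaussian_span X)) (\<lambda>\<omega>. h (X \<omega>)) \<omega> = h (X \<omega>) - c \<bullet> X \<omega>"
    using orth_proj_unique[OF H Z W ZW] by blast+
  note [measurable] = *(1)
  show ?thesis
  proof (rule integral_cong_AE)
    show "AE \<omega> in M. (orth_proj M (orth_complement M (gaussian_span X)) (\<lambda>\<omega>. h (X \<omega>)) \<omega> + a)\<^sup>2 = (h (X \<omega>) + a - c \<bullet> X \<omega>)\<^sup>2"
      using *(2) by eventually_elim (simp add: diff_add_eq)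
  qed measurable
qed

text \<open>Agrees with \<open>mean_P\<close> at an end of the arc, but refers to a single vector,
  so that limits can be taken for \<open>X\<close> and \<open>Y\<close> separately.\<close>

definition gibbs_mean :: "real \<Rightarrow> real ^ 'n \<Rightarrow> real ^ 'n" where
  "gibbs_mean \<beta> \<mu> = (\<chi> j. expectation (\<lambda>\<omega>. gibbs \<beta> (X \<omega> + \<mu>) j))"

lemma integrable_gibbs: "integrable M (\<lambda>\<omega>. gibbs \<beta> (X \<omega> + \<mu>) j)" if "0 < \<beta>"
proof -
  note [measurable] = has_tame_gradient_measurable'[OF softmax_tame[OF that]]
  show ?thesis by (rule integrable_const_bound[of _ 1]) (auto simp: gibbs_nonneg gibbs_le_1)
qed

lemma gibbs_mean_orthogonal:
  assumes \<beta>: "0 < \<beta>"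
  shows "expectation (\<lambda>\<omega>. X \<omega> $ k * softmax_residual \<beta> \<mu> (gibbs_mean \<beta> \<mu>) (X \<omega>)) = 0"
proof -
  have "expectation (\<lambda>\<omega>. gibbs \<beta> (X \<omega> + \<mu>) j - gibbs_mean \<beta> \<mu> $ j) = 0" for j
    by (simp add: integrable_gibbs[OF \<beta>] gibbs_mean_def prob_space)
  then show ?thesis
    by (subst gaussian_integration_by_parts[OF softmax_residual_tame[OF \<beta>]]) simp
qed

text \<open>Independence of \<open>\<beta>\<close> is the point: it provides compactness for the
  subsequence and domination in the limit.\<close>

lemma norm_gibbs_mean_le: "0 < \<beta> \<Longrightarrow> norm (gibbs_mean \<beta> \<mu>) \<le> real CARD('n)"
proof -
  assume \<beta>: "0 < \<beta>"
  have "\<bar>gibbs_mean \<beta> \<mu> $ j\<bar> \<le> 1" for j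
  proof -
    have "expectation (\<lambda>\<omega>. gibbs \<beta> (X \<omega> + \<mu>) j) \<le> expectation (\<lambda>_. 1)"
      by (intro Bochner_Integration.integral_mono integrable_gibbs[OF \<beta>]) (auto simp: gibbs_le_1)
    then show ?thesis by (simp add: gibbs_mean_def gibbs_nonneg prob_space)
  qed
  then have "(\<Sum>j\<in>UNIV. \<bar>gibbs_mean \<beta> \<mu> $ j\<bar>) \<le> (\<Sum>j\<in>(UNIV :: 'n set). 1)" by (intro sum_mono)
  then show ?thesis using norm_le_l1_cart[of "gibbs_mean \<beta> \<mu>"] by simp
qed

lemma orth_proj_softmax:
  assumes \<beta>: "0 < \<beta>"
  shows "expectation (\<lambda>\<omega>. (orth_proj M (orth_complement M (gaussian_span X)) (\<lambda>\<omega>. softmax \<beta> (X \<omega> + \<mu>)) \<omega> + 1 / \<beta>)\<^sup>2) =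
    expectation (\<lambda>\<omega>. (softmax_residual \<beta> \<mu> (gibbs_mean \<beta> \<mu>) (X \<omega>))\<^sup>2)"
proof -
  let ?c = "gibbs_mean \<beta> \<mu>"
  have t: "has_tame_gradient (\<lambda>x. softmax \<beta> (x + \<mu>)) (\<lambda>j x. gibbs \<beta> (x + \<mu>) j)"
    using has_tame_gradient_affine[OF softmax_tame[OF \<beta>], of 1 \<mu>] by simp
  obtain C where C: "\<And>x. \<bar>softmax \<beta> (x + \<mu>)\<bar> \<le> C * (1 + norm x)" using has_tame_gradient_bound[OF t] by metis
  \<comment> \<open>Centered coordinates are orthogonal to constants, so the normal equations are
    the same with and without \<open>1 / \<beta>\<close>.\<close>
  have "expectation (\<lambda>\<omega>. X \<omega> $ k * (softmax \<beta> (X \<omega> + \<mu>) - ?c \<bullet> X \<omega>)) = 0" for k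
  proof -
    have "X \<omega> $ k * (softmax \<beta> (X \<omega> + \<mu>) - ?c \<bullet> X \<omega>) = X \<omega> $ k * softmax_residual \<beta> \<mu> ?c (X \<omega>) - X \<omega> $ k * (1 / \<beta>)" for \<omega>
      unfolding softmax_residual_def right_diff_distrib distrib_left by simp
    then show ?thesis
      using integrable_nth_mult_tame(1)[OF softmax_residual_tame[OF \<beta>]] integrable_nth[of k] expectation_nth[of k]
      by (simp only: Bochner_Integration.integral_diff integrable_mult_left gibbs_mean_orthogonal[OF \<beta>] integral_mult_left_zero)
  qed
  from orth_proj_gaussian_span[OF has_tame_gradient_measurable[OF t] C this] show ?thesis
    by (simp add: softmax_residual_def)
qed

text \<open>Dominated convergence carries over both the second moments and the normal equations, so
  the limit \<open>c\<close> is a coefficient vector for the maximum. The lower bound on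
  \<open>\<beta> m\<close> keeps the correction terms bounded.\<close>

lemma softmax_residual_limit:
  assumes \<beta>: "\<And>m. 1 \<le> \<beta> m" "filterlim \<beta> at_top sequentially"
    and c: "(\<lambda>m. gibbs_mean (\<beta> m) \<mu>) \<longlonglongrightarrow> c"
  shows "(\<lambda>m. expectation (\<lambda>\<omega>. (softmax_residual (\<beta> m) \<mu> (gibbs_mean (\<beta> m) \<mu>) (X \<omega>))\<^sup>2)) \<longlonglongrightarrow>
    expectation (\<lambda>\<omega>. (orth_proj M (orth_complement M (gaussian_span X)) (\<lambda>\<omega>. MAX i. X \<omega> $ i + \<mu> $ i) \<omega>)\<^sup>2)"
proof -
  define h where "h x = (MAX i. (x + \<mu>) $ i)" for x :: "real ^ 'n"
  define r where "r m = softmax_residual (\<beta> m) \<mu> (gibbs_mean (\<beta> m) \<mu>)" for m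
  have \<beta>0: "0 < \<beta> m" for m using \<beta>(1)[of m] by linarith
  have [measurable]: "h \<in> borel_measurable borel" unfolding h_def by measurable
  have [measurable]: "r m \<in> borel_measurable borel" for m
    unfolding r_def by (rule has_tame_gradient_measurable[OF softmax_residual_tame[OF \<beta>0]])
  define L where "L = ln (real CARD('n))"
  have L: "0 \<le> L" by (simp add: L_def Suc_leI)
  \<comment> \<open>Collects the shift by \<open>\<mu>\<close>, the softmax excess
    \<open>L / \<beta> m\<close>, the constant \<open>1 / \<beta> m\<close> and the linear part,
    whose coefficients have norm at most \<open>CARD('n)\<close>.\<close>
  define C where "C = norm \<mu> + L + 2 + real CARD('n)"
  have hb: "\<bar>h x\<bar> \<le> norm x + norm \<mu>" for x
    unfolding h_def by (rule order_trans[OF abs_MAX_le_norm norm_triangle_ineq])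
  have C0: "0 \<le> C" using L by (simp add: C_def)
  have Cx: "norm x + norm \<mu> + (L + 1) + real CARD('n) * norm x \<le> C * (1 + norm x)" for x :: "real ^ 'n"
  proof -
    have "C * (1 + norm x) = norm x + norm \<mu> + (L + 1) + real CARD('n) * norm x + (1 + real CARD('n) + norm x + (norm \<mu> * norm x + L * norm x))"
      by (simp add: C_def algebra_simps)
    moreover have "0 \<le> norm \<mu> * norm x + L * norm x" using L by simp
    ultimately show ?thesis by simp
  qed
  have hC: "\<bar>h x\<bar> \<le> C * (1 + norm x)" for x
  proof -
    have "0 \<le> real CARD('n) * norm x" by simp
    then show ?thesis using hb[of x] Cx[of x] L by linarith
  qed
  have soft: "h x \<le> softmax (\<beta> m) (x + \<mu>)" "softmax (\<beta> m) (x + \<mu>) \<le> h x + L / \<beta> m" for x m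
    unfolding h_def L_def by (rule softmax_MAX[OF \<beta>0])+
  have rC: "\<bar>r m x\<bar> \<le> C * (1 + norm x)" for m x
  proof -
    have "L / \<beta> m \<le> L" "0 \<le> L / \<beta> m" "1 / \<beta> m \<le> 1" "0 \<le> 1 / \<beta> m"
      using L \<beta>(1)[of m] \<beta>0[of m] by (simp_all add: divide_le_eq mult_left_le mult_le_cancel_left1)
    moreover have "\<bar>gibbs_mean (\<beta> m) \<mu> \<bullet> x\<bar> \<le> real CARD('n) * norm x"
      by (rule order_trans[OF Cauchy_Schwarz_ineq2]) (intro mult_right_mono norm_gibbs_mean_le \<beta>0 norm_ge_zero)
    moreover have "h x \<le> softmax (\<beta> m) (x + \<mu>)" "softmax (\<beta> m) (x + \<mu>) \<le> h x + L / \<beta> m"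
      by (rule soft)+
    ultimately show ?thesis
      using hb[of x] Cx[of x] unfolding r_def softmax_residual_def by linarith
  qed
  have inv: "(\<lambda>m. d / \<beta> m) \<longlonglongrightarrow> 0" for d
    by (intro real_tendsto_divide_at_top[OF tendsto_const \<beta>(2)])
  have rlim: "(\<lambda>m. r m x) \<longlonglongrightarrow> h x - c \<bullet> x" for x
  proof -
    have s: "(\<lambda>m. softmax (\<beta> m) (x + \<mu>)) \<longlonglongrightarrow> h x"
    proof (rule tendsto_sandwich[of "\<lambda>_. h x" _ _ "\<lambda>m. h x + L / \<beta> m"])
      show "(\<lambda>m. h x + L / \<beta> m) \<longlonglongrightarrow> h x" using tendsto_add[OF tendsto_const inv, of "h x"] by simp
    qed (use soft in auto)
    show ?thesis unfolding r_def softmax_residual_def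
      using tendsto_diff[OF tendsto_add[OF s inv[of 1]] tendsto_inner[OF c tendsto_const]] by simp
  qed
  have quad: "integrable M (\<lambda>\<omega>. d * (1 + norm (X \<omega>))\<^sup>2)" for d
    by (rule integrable_quadratic_growth[of _ "\<bar>d\<bar>"]) (auto simp: abs_mult)
  have lim2: "(\<lambda>m. expectation (\<lambda>\<omega>. (r m (X \<omega>))\<^sup>2)) \<longlonglongrightarrow> expectation (\<lambda>\<omega>. (h (X \<omega>) - c \<bullet> X \<omega>)\<^sup>2)"
  proof (rule integral_dominated_convergence[OF _ _ quad[of "C\<^sup>2"]])
    show "AE \<omega> in M. (\<lambda>m. (r m (X \<omega>))\<^sup>2) \<longlonglongrightarrow> (h (X \<omega>) - c \<bullet> X \<omega>)\<^sup>2"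
      by (intro AE_I2 tendsto_power rlim)
    show "AE \<omega> in M. norm ((r m (X \<omega>))\<^sup>2) \<le> C\<^sup>2 * (1 + norm (X \<omega>))\<^sup>2" for m
    proof (rule AE_I2)
      show "norm ((r m (X \<omega>))\<^sup>2) \<le> C\<^sup>2 * (1 + norm (X \<omega>))\<^sup>2" for \<omega>
        using power_mono[OF rC[of m "X \<omega>"], of 2] by (simp add: power_mult_distrib)
    qed
  qed measurable
  \<comment> \<open>The normal equations hold for every \<open>m\<close> by
    \<open>gibbs_mean_orthogonal\<close> and pass to the limit.\<close>
  have "expectation (\<lambda>\<omega>. X \<omega> $ k * (h (X \<omega>) - c \<bullet> X \<omega>)) = 0" for k
  proof -
    have "(\<lambda>m. expectation (\<lambda>\<omega>. X \<omega> $ k * r m (X \<omega>))) \<longlonglongrightarrow> expectation (\<lambda>\<omega>. X \<omega> $ k * (h (X \<omega>) - c \<bullet> X \<omega>))"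
    proof (rule integral_dominated_convergence[OF _ _ quad[of C]])
      show "AE \<omega> in M. (\<lambda>m. X \<omega> $ k * r m (X \<omega>)) \<longlonglongrightarrow> X \<omega> $ k * (h (X \<omega>) - c \<bullet> X \<omega>)"
        by (intro AE_I2 tendsto_mult tendsto_const rlim)
      show "AE \<omega> in M. norm (X \<omega> $ k * r m (X \<omega>)) \<le> C * (1 + norm (X \<omega>))\<^sup>2" for m
      proof (rule AE_I2)
        fix \<omega>
        have "\<bar>X \<omega> $ k\<bar> * \<bar>r m (X \<omega>)\<bar> \<le> (1 + norm (X \<omega>)) * (C * (1 + norm (X \<omega>)))"
          using C0 by (intro mult_mono rC) (auto intro: order_trans[OF component_le_norm_cart])
        then show "norm (X \<omega> $ k * r m (X \<omega>)) \<le> C * (1 + norm (X \<omega>))\<^sup>2"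
          by (simp add: abs_mult power2_eq_square mult_ac)
      qed
    qed measurable
    moreover have "expectation (\<lambda>\<omega>. X \<omega> $ k * r m (X \<omega>)) = 0" for m
      unfolding r_def by (rule gibbs_mean_orthogonal[OF \<beta>0])
    ultimately show ?thesis by (simp add: LIMSEQ_const_iff)
  qed
  from orth_proj_gaussian_span[OF _ hC this, of 0] lim2 show ?thesis
    by (simp add: h_def r_def)
qed

end

section \<open>Both inequalities from the endpoints of the arc\<close>

theorem corollary1p4:
  fixes M :: "'a measure" and N :: "'b measure"
    and X :: "'a \<Rightarrow> real ^ 'n" and Y :: "'b \<Rightarrow> real ^ 'n" and \<mu> :: "real ^ 'n"
  assumes "prob_space M" and "prob_space N"
    and "\<And>i. 0 \<le> \<mu> $ i"
    and "centered_gaussian_vector M X" and "centered_gaussian_vector N Y"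
    and "\<And>i j. canonical_dist M X i j \<le> canonical_dist N Y i j"
  shows "(\<forall>\<beta>>0.
      (LINT \<omega>|M. (orth_proj M (orth_complement M (gaussian_span X))
          (\<lambda>\<omega>. softmax \<beta> (X \<omega> + \<mu>)) \<omega> + 1 / \<beta>)\<^sup>2)
      \<le> (LINT \<omega>|N. (orth_proj N (orth_complement N (gaussian_span Y))
          (\<lambda>\<omega>. softmax \<beta> (Y \<omega> + \<mu>)) \<omega> + 1 / \<beta>)\<^sup>2)) \<and>
    (LINT \<omega>|M. (orth_proj M (orth_complement M (gaussian_span X))
        (\<lambda>\<omega>. MAX i. X \<omega> $ i + \<mu> $ i) \<omega>)\<^sup>2)
    \<le> (LINT \<omega>|N. (orth_proj N (orth_complement N (gaussian_span Y))
        (\<lambda>\<omega>. MAX i. Y \<omega> $ i + \<mu> $ i) \<omega>)\<^sup>2)"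
proof -
  interpret X: centered_gaussian M X using assms by (simp add: centered_gaussian_def centered_gaussian_axioms_def)
  interpret Y: centered_gaussian N Y using assms by (simp add: centered_gaussian_def centered_gaussian_axioms_def)
  interpret gaussian_pair M X N Y ..
  have main: "X.expectation (\<lambda>\<omega>. (softmax_residual \<beta> \<mu> (X.gibbs_mean \<beta> \<mu>) (X \<omega>))\<^sup>2)
      \<le> Y.expectation (\<lambda>\<omega>. (softmax_residual \<beta> \<mu> (Y.gibbs_mean \<beta> \<mu>) (Y \<omega>))\<^sup>2)" if \<beta>: "0 < \<beta>" for \<beta>
  proof -
    interpret gaussian_comparison M X N Y \<beta> \<mu>
      by unfold_locales (use \<beta> assms(3,6) in \<open>auto simp: canonical_dist_def\<close>)
    note [measurable] = borel_measurable_integrable[OF X.integrable_gibbs[OF \<beta>]]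
      borel_measurable_integrable[OF Y.integrable_gibbs[OF \<beta>]] has_tame_gradient_measurable[OF resid_tame]
    \<comment> \<open>The arc starts at \<open>X\<close> and ends at \<open>Y\<close>, so the
      endpoint values are expectations on the original spaces.\<close>
    have arc: "arc 0 p = X (fst p)" "arc (pi / 2) p = Y (snd p)" for p by (simp_all add: mix_def)
    have "mean_P 0 = X.gibbs_mean \<beta> \<mu>"
      unfolding mean_P_def X.gibbs_mean_def arc by (subst expectation_fst) (auto simp: P_def)
    moreover have "mean_P (pi / 2) = Y.gibbs_mean \<beta> \<mu>"
      unfolding mean_P_def Y.gibbs_mean_def arc by (subst expectation_snd) (auto simp: P_def)
    moreover have "\<phi> c 0 = X.expectation (\<lambda>\<omega>. (softmax_residual \<beta> \<mu> c (X \<omega>))\<^sup>2)" for c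
      unfolding \<phi>_def arc by (subst expectation_fst[of "\<lambda>\<omega>. (softmax_residual \<beta> \<mu> c (X \<omega>))\<^sup>2"]) auto
    moreover have "\<phi> c (pi / 2) = Y.expectation (\<lambda>\<omega>. (softmax_residual \<beta> \<mu> c (Y \<omega>))\<^sup>2)" for c
      unfolding \<phi>_def arc by (subst expectation_snd[of "\<lambda>\<omega>. (softmax_residual \<beta> \<mu> c (Y \<omega>))\<^sup>2"]) auto
    ultimately show ?thesis using \<phi>_endpoints by simp
  qed
  define \<beta> where "\<beta> m = real (Suc m)" for m
  \<comment> \<open>Working with pairs yields a single subsequence along which the coefficients of
    \<open>X\<close> and of \<open>Y\<close> both converge.\<close>
  have "bounded (range (\<lambda>m. (X.gibbs_mean (\<beta> m) \<mu>, Y.gibbs_mean (\<beta> m) \<mu>)))"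
  proof (rule boundedI, clarify)
    show "norm (X.gibbs_mean (\<beta> m) \<mu>, Y.gibbs_mean (\<beta> m) \<mu>) \<le> real CARD('n) + real CARD('n)" for m
      by (rule order_trans[OF norm_Pair_le])
        (intro add_mono X.norm_gibbs_mean_le Y.norm_gibbs_mean_le; simp add: \<beta>_def)
  qed
  then obtain l r where r: "strict_mono r" "((\<lambda>m. (X.gibbs_mean (\<beta> m) \<mu>, Y.gibbs_mean (\<beta> m) \<mu>)) \<circ> r) \<longlonglongrightarrow> l"
    using bounded_imp_convergent_subsequence by blast
  have "(\<lambda>m. X.gibbs_mean (\<beta> (r m)) \<mu>) \<longlonglongrightarrow> fst l" "(\<lambda>m. Y.gibbs_mean (\<beta> (r m)) \<mu>) \<longlonglongrightarrow> snd l"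
    using tendsto_fst[OF r(2)] tendsto_snd[OF r(2)] by (simp_all add: comp_def)
  moreover have "filterlim (\<lambda>m. \<beta> (r m)) at_top sequentially"
  proof -
    have "filterlim \<beta> at_top sequentially"
      unfolding \<beta>_def by (rule filterlim_compose[OF filterlim_real_sequentially filterlim_Suc])
    then show ?thesis using filterlim_compose filterlim_subseq[OF r(1)] by blast
  qed
  moreover have "1 \<le> \<beta> (r m)" for m by (simp add: \<beta>_def)
  ultimately have "X.expectation (\<lambda>\<omega>. (orth_proj M (orth_complement M (gaussian_span X)) (\<lambda>\<omega>. MAX i. X \<omega> $ i + \<mu> $ i) \<omega>)\<^sup>2)
    \<le> Y.expectation (\<lambda>\<omega>. (orth_proj N (orth_complement N (gaussian_span Y)) (\<lambda>\<omega>. MAX i. Y \<omega> $ i + \<mu> $ i) \<omega>)\<^sup>2)"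
    by (intro LIMSEQ_le[OF X.softmax_residual_limit[of "\<lambda>m. \<beta> (r m)"] Y.softmax_residual_limit[of "\<lambda>m. \<beta> (r m)"]])
      (auto intro!: main simp: \<beta>_def)
  then show ?thesis using main X.orth_proj_softmax Y.orth_proj_softmax by simp
qed

end
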